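(* Let $p\colon\tilde X\to X$ be a covering map and $f\colon A\to\tilde X$ a map. Then, for the monomorphism $p_*\colon\pi_m(\tilde X)\to\pi_m(X)$ and every $m\ge 1$: (1) $G_m^f(\tilde X)=p_*^{-1}(G_m^{pf}(X))$; (2) $P_m^f(\tilde X)=p_*^{-1}(P_m^{pf}(X))$.
   Context: All spaces are path-connected with the homotopy type of CW-complexes; maps and homotopies are based. For a map $f\colon A\to X$ and $m\ge 1$: the generalized Gottlieb group $G_m^f(X)$ is the subgroup of $\pi_m(X)$ consisting of all elements which can be represented by a map $\alpha\colon\mathbb{S}^m\to X$ such that $f\vee\alpha\colon A\vee\mathbb{S}^m\to X$ extends (up to homotopy) to a map $A\times\mathbb{S}^m\to X$; the generalized Whitehead center group $P_m^f(X)$ is the subgroup of all $\alpha\in\pi_m(X)$ such that the Whitehead product $[\alpha,f\beta]$ is zero for all $\beta\in\pi_l(A)$, $l\ge 1$. Here $pf$ denotes the composite $A\to\tilde X\to X$. *)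

theory Defs
  imports "HOL-Analysis.Analysis" "HOL-Algebra.Group"
begin

section \<open>Covering maps\<close>

text \<open>The library constant \<^const>\<open>covering_space\<close> is tied to subsets of a type of class
  \<^class>\<open>topological_space\<close>; this is the same notion for abstract topologies
  (see \<open>covering_map_top_of_set\<close> below).\<close>

definition covering_map :: "'b topology \<Rightarrow> 'c topology \<Rightarrow> ('b \<Rightarrow> 'c) \<Rightarrow> bool" where
  "covering_map X' X p \<longleftrightarrow>
     continuous_map X' X p \<and> p ` topspace X' = topspace X \<and>
     (\<forall>x \<in> topspace X. \<exists>T. x \<in> T \<and> openin X T \<and>
        (\<exists>V. \<Union>V = {y \<in> topspace X'. p y \<in> T} \<and>
             (\<forall>U \<in> V. openin X' U) \<and>
             pairwise disjnt V \<and>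
             (\<forall>U \<in> V. homeomorphic_map (subtopology X' U) (subtopology X T) p)))"

lemma covering_map_top_of_set:
  "covering_map (top_of_set C) (top_of_set S) p \<longleftrightarrow> covering_space C p S"
proof -
  have eq: "{y \<in> C. p y \<in> T} = C \<inter> p -` T" for T by auto
  have "homeomorphic_maps (top_of_set U) (top_of_set T) p q \<longleftrightarrow> homeomorphism U T p q" for U T q
    unfolding homeomorphic_maps_def homeomorphism_def by (auto simp: Pi_iff) (metis image_eqI)+
  then have hom: "homeomorphic_map (top_of_set U) (top_of_set T) p \<longleftrightarrow> (\<exists>q. homeomorphism U T p q)"
    for U T
    by (simp add: homeomorphic_map_maps)
  have subC: "subtopology (top_of_set C) U = top_of_set U" if "openin (top_of_set C) U" for U
    using openin_imp_subset[OF that] by (simp add: subtopology_subtopology Int_absorb1)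
  have subS: "subtopology (top_of_set S) T = top_of_set T" if "openin (top_of_set S) T" for T
    using openin_imp_subset[OF that] by (simp add: subtopology_subtopology Int_absorb1)
  have "(\<forall>U\<in>V. homeomorphic_map (subtopology (top_of_set C) U) (subtopology (top_of_set S) T) p)
      \<longleftrightarrow> (\<forall>U\<in>V. \<exists>q. homeomorphism U T p q)"
    if "openin (top_of_set S) T" "\<forall>U\<in>V. openin (top_of_set C) U" for T V
    using that by (simp add: subC subS hom)
  moreover have im: "p \<in> C \<rightarrow> S" if "p ` C = S"
    using that by auto
  ultimately show ?thesis
    unfolding covering_map_def covering_space_def topspace_euclidean_subtopology eq
    by (simp cong: conj_cong) (rule iffI; elim conjE; intro conjI; (assumption | rule im))
qed

section \<open>CW complexes\<close>

definition disc :: "nat \<Rightarrow> (nat \<Rightarrow> real) topology" where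
  "disc n = subtopology (Euclidean_space n) {u. (\<Sum>i<n. (u i)\<^sup>2) \<le> 1}"

definition open_cell :: "nat \<Rightarrow> ((nat \<Rightarrow> real) \<Rightarrow> 'k) \<Rightarrow> 'k set" where
  "open_cell n \<Phi> = \<Phi> ` {u \<in> topspace (disc n). (\<Sum>i<n. (u i)\<^sup>2) < 1}"

text \<open>A cell structure is a set \<open>C\<close> of pairs (dimension, characteristic map).  The last two
  conditions are closure-finiteness and the weak topology.\<close>

definition CW_complex :: "'k topology \<Rightarrow> bool" where
  "CW_complex K \<longleftrightarrow> Hausdorff_space K \<and>
     (\<exists>C :: (nat \<times> ((nat \<Rightarrow> real) \<Rightarrow> 'k)) set.
        (\<forall>(n, \<Phi>) \<in> C. continuous_map (disc n) K \<Phi> \<and>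
            embedding_map (subtopology (disc n) {u. (\<Sum>i<n. (u i)\<^sup>2) < 1}) K \<Phi>) \<and>
        pairwise (\<lambda>c d. disjnt (case_prod open_cell c) (case_prod open_cell d)) C \<and>
        (\<Union>(n, \<Phi>) \<in> C. open_cell n \<Phi>) = topspace K \<and>
        (\<forall>(n, \<Phi>) \<in> C. \<exists>D \<subseteq> C. finite D \<and> (\<forall>(k, \<Psi>) \<in> D. k < n) \<and>
            \<Phi> ` {u \<in> topspace (disc n). (\<Sum>i<n. (u i)\<^sup>2) = 1} \<subseteq> (\<Union>(k, \<Psi>) \<in> D. open_cell k \<Psi>)) \<and>
        (\<forall>S \<subseteq> topspace K. closedin K S \<longleftrightarrow>
            (\<forall>(n, \<Phi>) \<in> C. closedin K (S \<inter> \<Phi> ` topspace (disc n)))))"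

section \<open>Homotopy groups\<close>

definition sphere_base :: "nat \<Rightarrow> real" where
  "sphere_base = (\<lambda>i. if i = 0 then 1 else 0)"

definition based_map :: "'s topology \<Rightarrow> 's \<Rightarrow> 'a topology \<Rightarrow> 'a \<Rightarrow> ('s \<Rightarrow> 'a) \<Rightarrow> bool" where
  "based_map S s0 X x0 \<alpha> \<longleftrightarrow> continuous_map S X \<alpha> \<and> \<alpha> s0 = x0"

definition based_homotopic ::
    "'s topology \<Rightarrow> 's \<Rightarrow> 'a topology \<Rightarrow> 'a \<Rightarrow> ('s \<Rightarrow> 'a) \<Rightarrow> ('s \<Rightarrow> 'a) \<Rightarrow> bool" where
  "based_homotopic S s0 X x0 = homotopic_with (\<lambda>h. h s0 = x0) S X"

definition sphere_class ::
    "nat \<Rightarrow> 'a topology \<Rightarrow> 'a \<Rightarrow> ((nat \<Rightarrow> real) \<Rightarrow> 'a) \<Rightarrow> ((nat \<Rightarrow> real) \<Rightarrow> 'a) set" where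
  "sphere_class n X x0 \<alpha> = {\<beta>. based_homotopic (nsphere n) sphere_base X x0 \<alpha> \<beta>}"

text \<open>\<open>pinch\<close> collapses the equator \<open>x 1 = 0\<close> of the sphere (which contains the base point)
  to the base point and maps each of the two closed hemispheres onto the whole sphere with
  degree 1.  On the circle it is angle doubling, so that \<open>sphere_mult\<close> is concatenation of loops.\<close>

definition pinch :: "(nat \<Rightarrow> real) \<Rightarrow> (nat \<Rightarrow> real)" where
  "pinch x = (\<lambda>i. if i = 0 then 1 - 2 * (x 1)\<^sup>2
                  else if i = 1 then 2 * x 1 * x 0
                  else 2 * \<bar>x 1\<bar> * x i)"

definition sphere_mult ::
    "((nat \<Rightarrow> real) \<Rightarrow> 'a) \<Rightarrow> ((nat \<Rightarrow> real) \<Rightarrow> 'a) \<Rightarrow> (nat \<Rightarrow> real) \<Rightarrow> 'a" where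
  "sphere_mult \<alpha> \<beta> = (\<lambda>x. if x 1 \<ge> 0 then \<alpha> (pinch x) else \<beta> (pinch x))"

text \<open>Meant for \<open>n \<ge> 1\<close>.\<close>

definition homotopy_group ::
    "nat \<Rightarrow> 'a topology \<Rightarrow> 'a \<Rightarrow> ((nat \<Rightarrow> real) \<Rightarrow> 'a) set monoid" where
  "homotopy_group n X x0 =
     \<lparr>carrier = {sphere_class n X x0 \<alpha> |\<alpha>. based_map (nsphere n) sphere_base X x0 \<alpha>},
      monoid.mult = (\<lambda>c d. \<Union>\<alpha>\<in>c. \<Union>\<beta>\<in>d. sphere_class n X x0 (sphere_mult \<alpha> \<beta>)),
      one = sphere_class n X x0 (\<lambda>_. x0)\<rparr>"

definition induced_hom ::
    "nat \<Rightarrow> 'b topology \<Rightarrow> 'b \<Rightarrow> ('a \<Rightarrow> 'b) \<Rightarrow> ((nat \<Rightarrow> real) \<Rightarrow> 'a) set \<Rightarrow> ((nat \<Rightarrow> real) \<Rightarrow> 'b) set" where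
  "induced_hom n Y y0 g c = (\<Union>\<alpha>\<in>c. sphere_class n Y y0 (g \<circ> \<alpha>))"

section \<open>Whitehead products\<close>

text \<open>\<open>disc_collapse n\<close> is the quotient map from the \<open>n\<close>-disc to the \<open>n\<close>-sphere that sends the
  boundary to the base point; the sign in coordinate 1 makes its degree 1.\<close>

definition disc_collapse :: "nat \<Rightarrow> (nat \<Rightarrow> real) \<Rightarrow> (nat \<Rightarrow> real)" where
  "disc_collapse n u =
     (let r2 = (\<Sum>i<n. (u i)\<^sup>2); s = sqrt (1 - r2)
      in (\<lambda>i. if i = 0 then 2 * r2 - 1
              else if i = 1 then - 2 * s * u 0
              else 2 * s * u (i - 1)))"

text \<open>The composite
  \<open>S\<^sup>m\<^sup>+\<^sup>l\<^sup>-\<^sup>1 \<cong> \<partial>(D\<^sup>m \<times> D\<^sup>l) = D\<^sup>m \<times> S\<^sup>l\<^sup>-\<^sup>1 \<union> S\<^sup>m\<^sup>-\<^sup>1 \<times> D\<^sup>l \<rightarrow> S\<^sup>m \<or> S\<^sup>l \<rightarrow> X\<close>.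
  The first map is radial projection of \<open>(u, v)\<close>, where \<open>(u, v)\<close> is the point \<open>x\<close> rotated
  by 45 degrees in the plane of the coordinates 0 and \<open>m\<close>, so that the base point
  has \<open>\<bar>u\<bar> = \<bar>v\<bar>\<close> and hence goes to a point of \<open>S\<^sup>m\<^sup>-\<^sup>1 \<times> S\<^sup>l\<^sup>-\<^sup>1\<close>, which is then sent to \<open>x0\<close>.\<close>

definition whitehead_map ::
    "nat \<Rightarrow> nat \<Rightarrow> ((nat \<Rightarrow> real) \<Rightarrow> 'a) \<Rightarrow> ((nat \<Rightarrow> real) \<Rightarrow> 'a) \<Rightarrow> (nat \<Rightarrow> real) \<Rightarrow> 'a" where
  "whitehead_map m l \<alpha> \<beta> x =
     (let u = (\<lambda>i. if i = 0 then (x 0 - x m) / sqrt 2 else if i < m then x i else 0);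
          v = (\<lambda>i. if i = 0 then (x 0 + x m) / sqrt 2 else if i < l then x (m + i) else 0);
          a = sqrt (\<Sum>i<m. (u i)\<^sup>2);
          b = sqrt (\<Sum>i<l. (v i)\<^sup>2)
      in if a \<le> b then \<alpha> (disc_collapse m (\<lambda>i. u i / b))
                  else \<beta> (disc_collapse l (\<lambda>i. v i / a)))"

definition whitehead_product ::
    "nat \<Rightarrow> nat \<Rightarrow> 'a topology \<Rightarrow> 'a \<Rightarrow> ((nat \<Rightarrow> real) \<Rightarrow> 'a) set \<Rightarrow> ((nat \<Rightarrow> real) \<Rightarrow> 'a) set
      \<Rightarrow> ((nat \<Rightarrow> real) \<Rightarrow> 'a) set" where
  "whitehead_product m l X x0 c d =
     (\<Union>\<alpha>\<in>c. \<Union>\<beta>\<in>d. sphere_class (m + l - 1) X x0 (whitehead_map m l \<alpha> \<beta>))"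

section \<open>Generalized Gottlieb and Whitehead center groups\<close>

text \<open>The wedge is the subspace \<open>A \<times> {s0} \<union> {a0} \<times> S\<close> of the product (the subspace topology
  always agrees with the quotient topology from the disjoint union).\<close>

definition wedge :: "'a topology \<Rightarrow> 'a \<Rightarrow> 's topology \<Rightarrow> 's \<Rightarrow> ('a \<times> 's) topology" where
  "wedge A a0 S s0 =
     subtopology (prod_topology A S) (topspace A \<times> {s0} \<union> {a0} \<times> topspace S)"

definition wedge_map :: "'s \<Rightarrow> ('a \<Rightarrow> 'x) \<Rightarrow> ('s \<Rightarrow> 'x) \<Rightarrow> 'a \<times> 's \<Rightarrow> 'x" where
  "wedge_map s0 f \<alpha> = (\<lambda>(a, s). if s = s0 then f a else \<alpha> s)"

definition gottlieb_group ::
    "nat \<Rightarrow> 'a topology \<Rightarrow> 'a \<Rightarrow> 'x topology \<Rightarrow> 'x \<Rightarrow> ('a \<Rightarrow> 'x) \<Rightarrow> ((nat \<Rightarrow> real) \<Rightarrow> 'x) set set" where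
  "gottlieb_group m A a0 X x0 f =
     {c \<in> carrier (homotopy_group m X x0).
        \<exists>\<alpha> \<in> c. \<exists>F. based_map (prod_topology A (nsphere m)) (a0, sphere_base) X x0 F \<and>
          based_homotopic (wedge A a0 (nsphere m) sphere_base) (a0, sphere_base) X x0
            F (wedge_map sphere_base f \<alpha>)}"

definition whitehead_center ::
    "nat \<Rightarrow> 'a topology \<Rightarrow> 'a \<Rightarrow> 'x topology \<Rightarrow> 'x \<Rightarrow> ('a \<Rightarrow> 'x) \<Rightarrow> ((nat \<Rightarrow> real) \<Rightarrow> 'x) set set" where
  "whitehead_center m A a0 X x0 f =
     {c \<in> carrier (homotopy_group m X x0).
        \<forall>l \<ge> 1. \<forall>d \<in> carrier (homotopy_group l A a0).
          whitehead_product m l X x0 c (induced_hom l X x0 f d)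
            = \<one>\<^bsub>homotopy_group (m + l - 1) X x0\<^esub>}"

end

theory Submission
  imports Defs
begin

text \<open>
  Homotopies lift along a covering \<open>p\<close>, whatever the space on which they are defined
  (\<open>covering_lift_homotopy\<close>), and two lifts of a map on a connected space are equal if they agree at
  one point (\<open>covering_lift_unique\<close>). So a based homotopy between \<open>p \<circ> \<alpha>\<close> and \<open>p \<circ> \<beta>\<close> lifts to one
  between \<open>\<alpha>\<close> and \<open>\<beta>\<close> (\<open>covering_reflects_based_homotopy\<close>), and \<open>p\<^sub>*\<close> is injective on all homotopy
  groups of positive degree.

  The statement on Whitehead centers is a formal consequence: Whitehead products are natural, so
  \<open>p\<^sub>*[\<gamma>, f \<delta>] = [p\<^sub>* \<gamma>, (p f) \<delta>]\<close>, and by injectivity one side vanishes if and only if the other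
  does. What has to be checked is that the explicit formulas for products of spherical maps are
  continuous and respect homotopies (\<open>based_homotopic_glue\<close>).

  For Gottlieb groups, composition with \<open>p\<close> gives one inclusion. For the other, let
  \<open>F: A \<times> S\<^sup>m \<rightarrow> X\<close> extend \<open>p f \<or> p \<gamma>\<close> up to homotopy. Lifting the homotopy on the wedge, starting
  from \<open>f \<or> \<gamma>\<close>, yields a lift \<open>E\<close> of \<open>F\<close> on \<open>A \<or> S\<^sup>m\<close> that is homotopic to \<open>f \<or> \<gamma>\<close>. It remains
  to extend \<open>E\<close> to a lift of \<open>F\<close> on the whole product (\<open>covering_lift_product\<close>). After pulling back
  along the collapse \<open>D\<^sup>m \<rightarrow> S\<^sup>m\<close>, a contraction of the disc makes this a problem of lifting a
  homotopy. The lift on \<open>A \<times> D\<^sup>m\<close> factors through \<open>A \<times> S\<^sup>m\<close>: over \<open>a0\<close> it does because \<open>E\<close> lifts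
  \<open>F\<close> on \<open>{a0} \<times> S\<^sup>m\<close>, and over other points of the connected space \<open>A\<close> by uniqueness of lifts.
\<close>

section \<open>Lifting along covering maps of abstract topologies\<close>

text \<open>Each sheet \<open>U\<close> over \<open>T\<close> is recorded through a local section \<open>q\<close> of \<open>p\<close> with values in
  \<open>U\<close>; composing with \<open>q\<close> is how maps into \<open>T\<close> are lifted below.\<close>

lemma covering_map_evenly_covered:
  assumes "covering_map X' X p" "x \<in> topspace X"
  obtains T V where "x \<in> T" "openin X T" "\<Union>V = {y \<in> topspace X'. p y \<in> T}"
    "\<forall>U\<in>V. openin X' U" "pairwise disjnt V"
    "\<forall>U\<in>V. \<exists>q. continuous_map (subtopology X T) X' q \<and>
        (\<forall>y\<in>U. q (p y) = y) \<and> (\<forall>z\<in>T. q z \<in> U \<and> p (q z) = z)"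
proof -
  from assms(1) have "\<forall>x \<in> topspace X. \<exists>T. x \<in> T \<and> openin X T \<and>
        (\<exists>V. \<Union>V = {y \<in> topspace X'. p y \<in> T} \<and> (\<forall>U \<in> V. openin X' U) \<and> pairwise disjnt V \<and>
             (\<forall>U \<in> V. homeomorphic_map (subtopology X' U) (subtopology X T) p))"
    unfolding covering_map_def by (elim conjE)
  from bspec[OF this assms(2)] obtain T V where TV: "x \<in> T" "openin X T"
    "\<Union>V = {y \<in> topspace X'. p y \<in> T}" "\<forall>U\<in>V. openin X' U" "pairwise disjnt V"
    and hom: "\<forall>U\<in>V. homeomorphic_map (subtopology X' U) (subtopology X T) p"
    by (elim exE conjE)
  have "\<forall>U\<in>V. \<exists>q. continuous_map (subtopology X T) X' q \<and>
        (\<forall>y\<in>U. q (p y) = y) \<and> (\<forall>z\<in>T. q z \<in> U \<and> p (q z) = z)"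
  proof
    fix U assume U: "U \<in> V"
    have tops: "topspace (subtopology X' U) = U" "topspace (subtopology X T) = T"
      using openin_subset[OF TV(2)] openin_subset[OF bspec[OF TV(4) U]] by auto
    obtain q where q: "homeomorphic_maps (subtopology X' U) (subtopology X T) p q"
      using hom U unfolding homeomorphic_map_maps by blast
    show "\<exists>q. continuous_map (subtopology X T) X' q \<and>
        (\<forall>y\<in>U. q (p y) = y) \<and> (\<forall>z\<in>T. q z \<in> U \<and> p (q z) = z)"
      using q unfolding homeomorphic_maps_def tops continuous_map_in_subtopology
      by (intro exI[of _ q]) auto
  qed
  then show ?thesis by (rule that[OF TV])
qed

text \<open>Near a point, both lifts stay in fixed sheets over one evenly covered set. If the sheets are
  the same, injectivity of \<open>p\<close> on it makes the lifts agree nearby; if not, the sheets are disjoint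
  and the lifts differ nearby. So the set where they agree is open and closed.\<close>

lemma covering_lift_unique:
  assumes cov: "covering_map X' X p" and conn: "connected_space Y"
    and g: "continuous_map Y X' g" and h: "continuous_map Y X' h"
    and eq: "\<And>y. y \<in> topspace Y \<Longrightarrow> p (g y) = p (h y)"
    and y0: "y0 \<in> topspace Y" "g y0 = h y0" and y: "y \<in> topspace Y"
  shows "g y = h y"
proof -
  have nbhd: "\<exists>N. openin Y N \<and> y \<in> N \<and> (\<forall>z\<in>N. (g z = h z) = (g y = h y))"
    if y: "y \<in> topspace Y" for y
  proof -
    have gX: "g y \<in> topspace X'" and hX: "h y \<in> topspace X'"
      using g h y by (auto simp: continuous_map_def)
    then have "p (g y) \<in> topspace X"
      using cov by (auto simp: covering_map_def)
    then obtain T V where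
      T: "p (g y) \<in> T" "openin X T" and V: "\<Union>V = {y \<in> topspace X'. p y \<in> T}"
      "\<forall>U\<in>V. openin X' U" and disj: "pairwise disjnt V"
      and q: "\<forall>U\<in>V. \<exists>q. continuous_map (subtopology X T) X' q \<and>
        (\<forall>y\<in>U. q (p y) = y) \<and> (\<forall>z\<in>T. q z \<in> U \<and> p (q z) = z)"
      by (rule covering_map_evenly_covered[OF cov]) (rule that; assumption)
    have "g y \<in> \<Union>V" "h y \<in> \<Union>V"
      using gX hX T(1) eq[OF y] unfolding V(1) by simp_all
    then obtain U W where U: "U \<in> V" "g y \<in> U" and W: "W \<in> V" "h y \<in> W"
      by blast
    have inj: "inj_on p U" using q U(1) by (metis inj_onI)
    let ?N = "{z \<in> topspace Y. g z \<in> U} \<inter> {z \<in> topspace Y. h z \<in> W}"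
    have "openin Y ?N"
      using g h U W V(2) openin_continuous_map_preimage by blast
    moreover have "y \<in> ?N" using U W y by simp
    moreover have "(g z = h z) = (g y = h y)" if z: "z \<in> ?N" for z
    proof (cases "U = W")
      case True
      have "g z = h z"
        using inj_onD[OF inj, of "g z" "h z"] eq[of z] z True by simp
      moreover have "g y = h y"
        using inj_onD[OF inj, of "g y" "h y"] eq[of y] y U W True by simp
      ultimately show ?thesis by simp
    next
      case False
      then have "disjnt U W" using disj U W by (meson pairwiseD)
      then show ?thesis using z U W by (auto simp: disjnt_iff)
    qed
    ultimately show ?thesis by (intro exI[of _ ?N] conjI ballI)
  qed
  have "openin Y {y \<in> topspace Y. g y = h y}"
  proof (subst openin_subopen, intro ballI)
    fix y assume y: "y \<in> {y \<in> topspace Y. g y = h y}"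
    then have "y \<in> topspace Y" by simp
    from nbhd[OF this] obtain N where N: "openin Y N" "y \<in> N" "\<forall>z\<in>N. (g z = h z) = (g y = h y)"
      by (elim exE conjE)
    have "N \<subseteq> {y \<in> topspace Y. g y = h y}"
    proof
      fix z assume "z \<in> N"
      then have "(g z = h z) = (g y = h y)" "z \<in> topspace Y"
        using bspec[OF N(3)] subsetD[OF openin_subset[OF N(1)]] by simp_all
      then show "z \<in> {y \<in> topspace Y. g y = h y}" using y by simp
    qed
    with N(1,2) show "\<exists>N. openin Y N \<and> y \<in> N \<and> N \<subseteq> {y \<in> topspace Y. g y = h y}"
      by blast
  qed
  moreover have "openin Y {y \<in> topspace Y. g y \<noteq> h y}"
  proof (subst openin_subopen, intro ballI)
    fix y assume y: "y \<in> {y \<in> topspace Y. g y \<noteq> h y}"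
    then have "y \<in> topspace Y" by simp
    from nbhd[OF this] obtain N where N: "openin Y N" "y \<in> N" "\<forall>z\<in>N. (g z = h z) = (g y = h y)"
      by (elim exE conjE)
    have "N \<subseteq> {y \<in> topspace Y. g y \<noteq> h y}"
    proof
      fix z assume "z \<in> N"
      then have "(g z = h z) = (g y = h y)" "z \<in> topspace Y"
        using bspec[OF N(3)] subsetD[OF openin_subset[OF N(1)]] by simp_all
      then show "z \<in> {y \<in> topspace Y. g y \<noteq> h y}" using y by simp
    qed
    with N(1,2) show "\<exists>N. openin Y N \<and> y \<in> N \<and> N \<subseteq> {y \<in> topspace Y. g y \<noteq> h y}"
      by blast
  qed
  moreover have "topspace Y - {y \<in> topspace Y. g y = h y} = {y \<in> topspace Y. g y \<noteq> h y}"
    by auto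
  ultimately have "{y \<in> topspace Y. g y = h y} = {} \<or> {y \<in> topspace Y. g y = h y} = topspace Y"
    using conn[unfolded connected_space_clopen_in, rule_format, of "{y \<in> topspace Y. g y = h y}"]
    by (simp only: closedin_def) simp
  with y0 y show ?thesis by auto
qed

text \<open>The parameter is the first factor, as in the homotopies of \<^const>\<open>homotopic_with\<close>.\<close>

abbreviation strip :: "real set \<Rightarrow> 'y topology \<Rightarrow> (real \<times> 'y) topology"
  where "strip J Y \<equiv> prod_topology (top_of_set J) Y"

lemma continuous_map_strip_slice:
  assumes "continuous_map (strip J Y) Z K" "t \<in> J"
  shows "continuous_map Y Z (\<lambda>y. K (t, y))"
  using continuous_map_o_Pair[OF assms(1), of t] assms(2) by (simp add: o_def)

lemma continuous_map_strip_track: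
  assumes "continuous_map (strip J Y) Z K" "y \<in> topspace Y"
  shows "continuous_map (top_of_set J) Z (\<lambda>t. K (t, y))"
  using continuous_map_compose[OF _ assms(1), of _ "\<lambda>t. (t, y)"] assms(2)
  by (simp add: o_def continuous_map_pairwise)

lemma continuous_map_strip_subset:
  assumes "continuous_map (strip J (subtopology Y N)) Z K" "J' \<subseteq> J" "N' \<subseteq> N"
  shows "continuous_map (strip J' (subtopology Y N')) Z K"
proof -
  have "strip J (subtopology Y N) = subtopology (prod_topology euclideanreal Y) (J \<times> N)" for J N
    by (simp add: subtopology_Times)
  with assms show ?thesis
    by (auto intro: continuous_map_from_subtopology_mono)
qed

lemma continuous_map_strip_glue:
  assumes K: "continuous_map (strip {r..s} Y) Z K" and L: "continuous_map (strip {s..t} Y) Z L"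
    and eq: "\<And>y. y \<in> topspace Y \<Longrightarrow> K (s, y) = L (s, y)" and st: "r \<le> s" "s \<le> t"
  shows "continuous_map (strip {r..t} Y) Z (\<lambda>z. if fst z \<le> s then K z else L z)"
proof (rule continuous_map_cases_le)
  have sub: "subtopology (strip {r..t} Y) {z \<in> topspace (strip {r..t} Y). fst z \<in> J}
      = strip ({r..t} \<inter> J) Y" for J
  proof -
    have "{z \<in> topspace (strip {r..t} Y). fst z \<in> J} = ({r..t} \<inter> J) \<times> topspace Y" by auto
    then show ?thesis by (simp add: subtopology_Times subtopology_subtopology Int_absorb1 Int_left_absorb)
  qed
  show "continuous_map (strip {r..t} Y) euclideanreal fst"
    using continuous_map_fst continuous_map_into_fulltopology by blast
  have "{r..t} \<inter> {..s} = {r..s}" "{r..t} \<inter> {s..} = {s..t}" using st by auto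
  then show
    "continuous_map (subtopology (strip {r..t} Y) {x \<in> topspace (strip {r..t} Y). fst x \<le> s}) Z K"
    "continuous_map (subtopology (strip {r..t} Y) {x \<in> topspace (strip {r..t} Y). s \<le> fst x}) Z L"
    using K L sub[of "{..s}"] sub[of "{s..}"] by (simp_all only: atMost_iff atLeast_iff)
qed (use eq in auto)

text \<open>The lift near \<open>y\<close> is built along the time axis. Over a short time interval and a small
  neighbourhood of \<open>y\<close> the homotopy stays in one evenly covered set, and a local section lifts it.
  Bolzano's principle joins these pieces without an explicit choice of a subdivision.\<close>

lemma covering_lift_homotopy_local:
  assumes cov: "covering_map X' X p"
    and H: "continuous_map (strip {0..1} Y) X H" and y: "y \<in> topspace Y"
    and g: "continuous_map Y X' g" and pg: "\<And>z. z \<in> topspace Y \<Longrightarrow> p (g z) = H (0, z)"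
  shows "\<exists>N K. openin Y N \<and> y \<in> N \<and> continuous_map (strip {0..1} (subtopology Y N)) X' K \<and>
      (\<forall>z\<in>N. K (0, z) = g z) \<and> (\<forall>t\<in>{0..1}. \<forall>z\<in>N. p (K (t, z)) = H (t, z))"
proof -
  \<comment> \<open>Every lift at time \<open>s\<close> near \<open>y\<close> extends over \<open>[s, t]\<close> after shrinking its domain. Quantifying
    over the domain \<open>M\<close> and the initial lift \<open>g\<close> is what makes \<open>P\<close> transitive.\<close>
  define P where "P s t \<longleftrightarrow> 0 \<le> s \<longrightarrow> t \<le> 1 \<longrightarrow>
    (\<forall>M g. openin Y M \<longrightarrow> y \<in> M \<longrightarrow> continuous_map (subtopology Y M) X' g \<longrightarrow>
       (\<forall>z\<in>M. p (g z) = H (s, z)) \<longrightarrow>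
       (\<exists>N K. openin Y N \<and> y \<in> N \<and> N \<subseteq> M \<and>
          continuous_map (strip {s..t} (subtopology Y N)) X' K \<and>
          (\<forall>z\<in>N. K (s, z) = g z) \<and> (\<forall>r\<in>{s..t}. \<forall>z\<in>N. p (K (r, z)) = H (r, z))))"
    for s t :: real
  have P_D: "\<exists>N K. openin Y N \<and> y \<in> N \<and> N \<subseteq> M \<and>
          continuous_map (strip {s..t} (subtopology Y N)) X' K \<and>
          (\<forall>z\<in>N. K (s, z) = g z) \<and> (\<forall>r\<in>{s..t}. \<forall>z\<in>N. p (K (r, z)) = H (r, z))"
    if "P s t" "0 \<le> s" "t \<le> 1" "openin Y M" "y \<in> M" "continuous_map (subtopology Y M) X' g"
       "\<forall>z\<in>M. p (g z) = H (s, z)" for s t M g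
    using that unfolding P_def by simp
  have "P 0 1"
  proof (rule Bolzano[of _ _ P])
    show "(0::real) \<le> 1" by simp
  next
    fix r s t assume IH: "P r s" "P s t" and le: "r \<le> s" "s \<le> t"
    show "P r t"
      unfolding P_def
    proof (intro impI allI)
      fix M g assume bd: "0 \<le> r" "t \<le> 1" and M: "openin Y M" "y \<in> M"
        and g: "continuous_map (subtopology Y M) X' g" "\<forall>z\<in>M. p (g z) = H (r, z)"
      obtain N K where N: "openin Y N" "y \<in> N" "N \<subseteq> M"
        and K: "continuous_map (strip {r..s} (subtopology Y N)) X' K"
          "\<forall>z\<in>N. K (r, z) = g z" "\<forall>u\<in>{r..s}. \<forall>z\<in>N. p (K (u, z)) = H (u, z)"
        using P_D[OF IH(1) _ _ M g] le bd by auto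
      have "continuous_map (subtopology Y N) X' (\<lambda>z. K (s, z))" "\<forall>z\<in>N. p (K (s, z)) = H (s, z)"
        using continuous_map_strip_slice[OF K(1)] K(3) le by auto
      then obtain N' L where N': "openin Y N'" "y \<in> N'" "N' \<subseteq> N"
        and L: "continuous_map (strip {s..t} (subtopology Y N')) X' L"
          "\<forall>z\<in>N'. L (s, z) = K (s, z)" "\<forall>u\<in>{s..t}. \<forall>z\<in>N'. p (L (u, z)) = H (u, z)"
        using P_D[OF IH(2) _ _ N(1,2), of "\<lambda>z. K (s, z)"] le bd by auto
      let ?K = "\<lambda>z. if fst z \<le> s then K z else L z"
      have "continuous_map (strip {r..t} (subtopology Y N')) X' ?K"
        using continuous_map_strip_subset[OF K(1) order_refl N'(3)] L le
        by (intro continuous_map_strip_glue) auto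
      then show "\<exists>N K. openin Y N \<and> y \<in> N \<and> N \<subseteq> M \<and>
          continuous_map (strip {r..t} (subtopology Y N)) X' K \<and>
          (\<forall>z\<in>N. K (r, z) = g z) \<and> (\<forall>u\<in>{r..t}. \<forall>z\<in>N. p (K (u, z)) = H (u, z))"
        using N N' K(2,3) L(3) le
        by (intro exI[of _ N'] exI[of _ ?K]) auto
    qed
  next
    fix x :: real assume x: "0 \<le> x" "x \<le> 1"
    then have "H (x, y) \<in> topspace X"
      using H y by (auto simp: continuous_map_def)
    then obtain T V where
      T: "H (x, y) \<in> T" "openin X T" and V: "\<Union>V = {y \<in> topspace X'. p y \<in> T}"
      "\<forall>U\<in>V. openin X' U" and "pairwise disjnt V"
      and q: "\<forall>U\<in>V. \<exists>q. continuous_map (subtopology X T) X' q \<and>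
        (\<forall>y\<in>U. q (p y) = y) \<and> (\<forall>z\<in>T. q z \<in> U \<and> p (q z) = z)"
      by (rule covering_map_evenly_covered[OF cov]) (rule that; assumption)
    have "openin (strip {0..1} Y) {z \<in> topspace (strip {0..1} Y). H z \<in> T}"
      using H T(2) openin_continuous_map_preimage by blast
    moreover have "(x, y) \<in> {z \<in> topspace (strip {0..1} Y). H z \<in> T}" using x y T by simp
    ultimately obtain J B where J: "openin (top_of_set {0..1}) J" "x \<in> J"
      and B: "openin Y B" "y \<in> B" and JB: "J \<times> B \<subseteq> {z \<in> topspace (strip {0..1} Y). H z \<in> T}"
      unfolding openin_prod_topology_alt by meson
    obtain d where d: "d > 0" "\<And>u. u \<in> {0..1} \<Longrightarrow> dist u x < d \<Longrightarrow> u \<in> J"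
      using J unfolding openin_euclidean_subtopology_iff by blast
    have "P s t" if st: "s \<le> x" "x \<le> t" "t - s < d" for s t
      unfolding P_def
    proof (intro impI allI)
      fix M g assume bd: "0 \<le> s" "t \<le> 1" and M: "openin Y M" "y \<in> M"
        and g: "continuous_map (subtopology Y M) X' g" "\<forall>z\<in>M. p (g z) = H (s, z)"
      have inJ: "{s..t} \<subseteq> J"
        using d(2) st bd by (auto simp: dist_real_def)
      have HT: "H (u, z) \<in> T" if "u \<in> {s..t}" "z \<in> B" for u z
        using JB inJ that by blast
      have "g y \<in> topspace X'" "p (g y) \<in> T"
        using g M HT[of s y] B st openin_subset[OF M(1)] by (auto simp: continuous_map_def)
      with V obtain U where U: "U \<in> V" "g y \<in> U" by blast
      obtain q where qc: "continuous_map (subtopology X T) X' q"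
        and qp: "\<forall>y\<in>U. q (p y) = y" and pq: "\<forall>z\<in>T. q z \<in> U \<and> p (q z) = z"
        using q U(1) by blast
      define N where "N = {z \<in> topspace (subtopology Y M). g z \<in> U} \<inter> B"
      have "openin (subtopology Y M) {z \<in> topspace (subtopology Y M). g z \<in> U}"
        using g(1) V(2) U(1) openin_continuous_map_preimage by blast
      then have "openin Y N"
        unfolding N_def using M(1) B(1) openin_trans_full by blast
      moreover have "y \<in> N" "N \<subseteq> M" "N \<subseteq> B"
        using M B U openin_subset[OF M(1)] by (auto simp: N_def)
      moreover have "continuous_map (strip {s..t} (subtopology Y N)) X' (q \<circ> H)"
      proof (rule continuous_map_compose[OF _ qc])
        have "continuous_map (strip {0..1} (subtopology Y (topspace Y))) X H"
          using H by simp
        then have "continuous_map (strip {s..t} (subtopology Y N)) X H"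
          using bd openin_subset[OF \<open>openin Y N\<close>]
          by - (rule continuous_map_strip_subset, assumption, auto)
        then show "continuous_map (strip {s..t} (subtopology Y N)) (subtopology X T) H"
          using HT \<open>N \<subseteq> B\<close> by (auto simp: continuous_map_in_subtopology)
      qed
      moreover have "(q \<circ> H) (s, z) = g z" if "z \<in> N" for z
        using that g(2) qp by (auto simp: N_def)
      ultimately show "\<exists>N K. openin Y N \<and> y \<in> N \<and> N \<subseteq> M \<and>
          continuous_map (strip {s..t} (subtopology Y N)) X' K \<and>
          (\<forall>z\<in>N. K (s, z) = g z) \<and> (\<forall>r\<in>{s..t}. \<forall>z\<in>N. p (K (r, z)) = H (r, z))"
        using pq HT by (intro exI[of _ N] exI[of _ "q \<circ> H"]) auto
    qed
    with d(1) show "\<exists>d>0. \<forall>a b. a \<le> x \<and> x \<le> b \<and> b - a < d \<longrightarrow> P a b" by blast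
  qed
  from P_D[OF this _ _ openin_topspace y, of g] show ?thesis
    using g pg by auto
qed

text \<open>Two local lifts agree where both are defined, because for fixed \<open>y\<close> they lift the same path
  from the same starting point; so they paste together, over an arbitrary space \<open>Y\<close>.\<close>

theorem covering_lift_homotopy:
  assumes cov: "covering_map X' X p"
    and H: "continuous_map (strip {0..1} Y) X H"
    and g: "continuous_map Y X' g" and pg: "\<forall>y\<in>topspace Y. p (g y) = H (0, y)"
  shows "\<exists>K. continuous_map (strip {0..1} Y) X' K \<and> (\<forall>y\<in>topspace Y. K (0, y) = g y) \<and>
    (\<forall>t\<in>{0..1}. \<forall>y\<in>topspace Y. p (K (t, y)) = H (t, y))"
proof -
  have "\<forall>y\<in>topspace Y. \<exists>N K. openin Y N \<and> y \<in> N \<and>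
      continuous_map (strip {0..1} (subtopology Y N)) X' K \<and>
      (\<forall>z\<in>N. K (0, z) = g z) \<and> (\<forall>t\<in>{0..1}. \<forall>z\<in>N. p (K (t, z)) = H (t, z))"
    using covering_lift_homotopy_local[OF cov H _ g] pg by simp
  from bchoice[OF this] obtain N where "\<forall>y\<in>topspace Y. \<exists>K. openin Y (N y) \<and> y \<in> N y \<and>
      continuous_map (strip {0..1} (subtopology Y (N y))) X' K \<and>
      (\<forall>z\<in>N y. K (0, z) = g z) \<and> (\<forall>t\<in>{0..1}. \<forall>z\<in>N y. p (K (t, z)) = H (t, z))" ..
  from bchoice[OF this] obtain K where NK: "\<forall>y\<in>topspace Y. openin Y (N y) \<and> y \<in> N y \<and>
      continuous_map (strip {0..1} (subtopology Y (N y))) X' (K y) \<and>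
      (\<forall>z\<in>N y. K y (0, z) = g z) \<and> (\<forall>t\<in>{0..1}. \<forall>z\<in>N y. p (K y (t, z)) = H (t, z))" ..
  then have N: "\<And>y. y \<in> topspace Y \<Longrightarrow> openin Y (N y) \<and> y \<in> N y"
    and Kc: "\<And>y. y \<in> topspace Y \<Longrightarrow> continuous_map (strip {0..1} (subtopology Y (N y))) X' (K y)"
    and K0: "\<And>y z. y \<in> topspace Y \<Longrightarrow> z \<in> N y \<Longrightarrow> K y (0, z) = g z"
    and pK: "\<And>y z t. \<lbrakk>y \<in> topspace Y; z \<in> N y; 0 \<le> t; t \<le> 1\<rbrakk> \<Longrightarrow> p (K y (t, z)) = H (t, z)"
    by simp_all
  have track: "continuous_map (top_of_set {0..1}) X' (\<lambda>t. K y (t, z))"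
    if "y \<in> topspace Y" "z \<in> N y" for y z
  proof -
    have "z \<in> topspace (subtopology Y (N y))"
      using that(2) N[OF that(1)] openin_subset[of Y "N y"] by auto
    from continuous_map_strip_track[OF Kc[OF that(1)] this] show ?thesis .
  qed
  have agree: "K y (t, z) = K y' (t, z)"
    if "y \<in> topspace Y" "y' \<in> topspace Y" "z \<in> N y" "z \<in> N y'" "0 \<le> t" "t \<le> 1" for y y' z t
  proof (rule covering_lift_unique[OF cov _ track[OF that(1,3)] track[OF that(2,4)], where ?y0.0 = 0])
    show "connected_space (top_of_set {0..1::real})"
      by (simp add: connected_space_subtopology)
  qed (use that K0 pK in simp_all)
  let ?L = "\<lambda>z. K (snd z) z"
  have "continuous_map (strip {0..1} Y) X' ?L"
  proof (rule pasting_lemma[where I = "topspace Y" and T = "\<lambda>y. {0..1} \<times> N y" and f = K])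
    show "openin (strip {0..1} Y) ({0..1} \<times> N i)" if "i \<in> topspace Y" for i
      using N that by (simp add: openin_prod_Times_iff)
    show "continuous_map (subtopology (strip {0..1} Y) ({0..1} \<times> N i)) X' (K i)"
      if "i \<in> topspace Y" for i
      using Kc[OF that] by (simp add: subtopology_Times subtopology_subtopology)
    show "K i x = K j x" if "i \<in> topspace Y" "j \<in> topspace Y"
      "x \<in> topspace (strip {0..1} Y) \<inter> {0..1} \<times> N i \<inter> {0..1} \<times> N j" for i j x
      using that agree[of i j "snd x" "fst x"] by auto
    show "\<exists>j. j \<in> topspace Y \<and> x \<in> {0..1} \<times> N j \<and> K (snd x) x = K j x"
      if "x \<in> topspace (strip {0..1} Y)" for x
      using that N by (intro exI[of _ "snd x"]) auto
  qed
  moreover have "?L (0, y) = g y" if "y \<in> topspace Y" for y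
    using K0[OF that] N[OF that] by simp
  moreover have "p (?L (t, y)) = H (t, y)" if "t \<in> {0..1}" "y \<in> topspace Y" for t y
    using pK[OF that(2), of y t] that(1) N[OF that(2)] by simp
  ultimately show ?thesis by (intro exI[of _ ?L] conjI ballI)
qed

section \<open>Lifting maps defined on products\<close>

text \<open>To lift \<open>F\<close> on \<open>A \<times> S\<close> it suffices to lift it on the two axes. Pulling back along a
  surjection \<open>q\<close> from a contractible space \<open>B\<close> turns the problem into one of lifting a homotopy
  that starts at \<open>A \<times> {s0}\<close>; this replaces the lifting criterion through fundamental groups,
  which asks for a locally path-connected domain. The lift \<open>L\<close> on \<open>A \<times> B\<close> descends to \<open>A \<times> S\<close>: when
  \<open>q b = q b'\<close>, the maps \<open>L (-, b)\<close> and \<open>L (-, b')\<close> lift the same map on the connected space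
  \<open>A\<close>, and at \<open>a0\<close> they agree because there the lift comes from \<open>h\<close>. Compactness of \<open>B\<close> makes
  \<open>id \<times> q\<close> a proper map, hence a quotient map.\<close>

lemma covering_lift_product:
  assumes cov: "covering_map X' X p"
    and A: "connected_space A" "a0 \<in> topspace A"
    and B: "contractible_space B" "compact_space B" "b0 \<in> topspace B"
    and S: "Hausdorff_space S"
    and q: "continuous_map B S q" "q ` topspace B = topspace S" "q b0 = s0"
    and F: "continuous_map (prod_topology A S) X F"
    and g: "continuous_map A X' g" and pg: "\<forall>a\<in>topspace A. p (g a) = F (a, s0)"
    and h: "continuous_map S X' h" and ph: "\<forall>s\<in>topspace S. p (h s) = F (a0, s)"
    and gh: "g a0 = h s0"
  shows "\<exists>G. continuous_map (prod_topology A S) X' G \<and>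
    (\<forall>a\<in>topspace A. \<forall>s\<in>topspace S. p (G (a, s)) = F (a, s)) \<and>
    (\<forall>a\<in>topspace A. G (a, s0) = g a) \<and> (\<forall>s\<in>topspace S. G (a0, s) = h s)"
proof -
  let ?AB = "prod_topology A B" and ?I = "top_of_set {0..1::real}"
  have "homotopic_with (\<lambda>x. True) B B (\<lambda>x. b0) id"
    using B(1,3) unfolding contractible_space_alt by (blast intro: homotopic_with_symD)
  then obtain k where k: "continuous_map (strip {0..1} B) B k" "\<forall>b. k (0, b) = b0" "\<forall>b. k (1, b) = b"
    unfolding homotopic_with_def id_def by (elim exE conjE)
  \<comment> \<open>Contract the factor \<open>B\<close> and lift the resulting homotopy, starting from \<open>g\<close>.\<close>
  let ?H = "\<lambda>z. F (fst (snd z), q (k (fst z, snd (snd z))))"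
  have proj: "continuous_map (strip {0..1::real} ?AB) A (\<lambda>z. fst (snd z))"
    "continuous_map (strip {0..1::real} ?AB) (strip {0..1} B) (\<lambda>z. (fst z, snd (snd z)))"
    using continuous_map_compose[OF continuous_map_snd continuous_map_fst, of ?I A B]
      continuous_map_compose[OF continuous_map_snd continuous_map_snd, of ?I A B]
    by (simp_all add: continuous_map_pairwise o_def continuous_map_fst)
  have H: "continuous_map (strip {0..1} ?AB) X ?H"
  proof -
    have "continuous_map (strip {0..1} ?AB) S (\<lambda>z. q (k (fst z, snd (snd z))))"
      using continuous_map_compose[OF continuous_map_compose[OF proj(2) k(1)] q(1)] by (simp add: o_def)
    then have "continuous_map (strip {0..1} ?AB) (prod_topology A S)
        (\<lambda>z. (fst (snd z), q (k (fst z, snd (snd z)))))"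
      using proj(1) by (simp add: continuous_map_pairwise o_def)
    from continuous_map_compose[OF this F] show ?thesis by (simp add: o_def)
  qed
  have gc: "continuous_map ?AB X' (g \<circ> fst)"
    by (rule continuous_map_compose[OF continuous_map_fst g])
  have pgc: "\<forall>z\<in>topspace ?AB. p ((g \<circ> fst) z) = ?H (0, z)"
    using pg k(2) q(3) by simp
  from covering_lift_homotopy[OF cov H gc pgc]
  obtain K where K: "continuous_map (strip {0..1} ?AB) X' K"
    and K0: "\<forall>z\<in>topspace ?AB. K (0, z) = (g \<circ> fst) z"
    and pK: "\<forall>t\<in>{0..1}. \<forall>z\<in>topspace ?AB. p (K (t, z)) = ?H (t, z)"
    by (elim exE conjE)
  define L where "L = (\<lambda>z. K (1, z))"
  have L: "continuous_map ?AB X' L"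
    unfolding L_def by (rule continuous_map_strip_slice[OF K]) simp
  have pL: "p (L (a, b)) = F (a, q b)" if "a \<in> topspace A" "b \<in> topspace B" for a b
    using pK that k(3) by (simp add: L_def)
  have row: "continuous_map A X' (\<lambda>a. L (a, b))" if "b \<in> topspace B" for b
    using continuous_map_compose[OF _ L, of A "\<lambda>a. (a, b)"] that
    by (simp add: o_def continuous_map_pairwise)
  have col: "continuous_map B X' (\<lambda>b. L (a, b))" if "a \<in> topspace A" for a
    using continuous_map_o_Pair[OF L that] by (simp add: o_def)
  \<comment> \<open>Over \<open>a0\<close> the lift is \<open>h \<circ> q\<close>, by uniqueness of lifted paths.\<close>
  have La0: "L (a0, b) = h (q b)" if b: "b \<in> topspace B" for b
  proof -
    have pt: "(a0, b) \<in> topspace ?AB" using A(2) b by simp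
    have kb: "continuous_map ?I B (\<lambda>t. k (t, b))"
      by (rule continuous_map_strip_track[OF k(1) b])
    have "K (1, (a0, b)) = h (q (k (1, b)))"
    proof (rule covering_lift_unique[OF cov _ continuous_map_strip_track[OF K pt], where ?y0.0 = 0])
      show "connected_space ?I" by (simp add: connected_space_subtopology)
      show "continuous_map ?I X' (\<lambda>t. h (q (k (t, b))))"
        using continuous_map_compose[OF continuous_map_compose[OF kb q(1)] h] by (simp add: o_def)
      show "p (K (t, (a0, b))) = p (h (q (k (t, b))))" if "t \<in> topspace ?I" for t
      proof -
        have "q (k (t, b)) \<in> topspace S"
          using kb q(1) that by (auto simp: continuous_map_def)
        then show ?thesis using pK pt that ph by simp
      qed
      show "K (0, (a0, b)) = h (q (k (0, b)))"
        using K0 pt gh k(2) q(3) by simp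
    qed simp_all
    then show ?thesis using k(3) by (simp add: L_def)
  qed
  have Lb0: "L (a, b0) = g a" if a: "a \<in> topspace A" for a
  proof (rule covering_lift_unique[OF cov A(1) row[OF B(3)] g _ A(2) _ a])
    show "p (L (a, b0)) = p (g a)" if "a \<in> topspace A" for a
      using pL[OF that B(3)] pg that q(3) by simp
    show "L (a0, b0) = g a0" using La0[OF B(3)] gh q(3) by simp
  qed
  have fib: "L (a, b) = L (a, b')" if "a \<in> topspace A" "b \<in> topspace B" "b' \<in> topspace B" "q b = q b'"
    for a b b'
    by (rule covering_lift_unique[OF cov A(1) row row _ A(2)])
      (use that pL La0 in auto)
  \<comment> \<open>Proper maps are closed, and stay proper under products with an arbitrary space; a quotient map
    \<open>q\<close> need not stay one.\<close>
  let ?Q = "\<lambda>(a, b). (a, q b)"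
  have "quotient_map ?AB (prod_topology A S) ?Q"
  proof (rule continuous_closed_imp_quotient_map)
    have "proper_map B S q"
      by (rule continuous_imp_proper_map[OF B(2) Hausdorff_imp_kc_space[OF S] q(1)])
    moreover have "proper_map A A (\<lambda>a. a)"
      using proper_map_id[of A] by (simp only: id_def)
    ultimately have "proper_map ?AB (prod_topology A S) ?Q"
      using proper_map_prod[of A B A S "\<lambda>a. a" q] by blast
    then show "closed_map ?AB (prod_topology A S) ?Q" by (rule proper_imp_closed_map)
    show "continuous_map ?AB (prod_topology A S) ?Q"
      using continuous_map_prod_top[of A B A S "\<lambda>a. a" q] q(1) by simp
    show "?Q ` topspace ?AB = topspace (prod_topology A S)"
      unfolding topspace_prod_topology q(2)[symmetric] by force
  qed
  then obtain G where G: "continuous_map (prod_topology A S) X' G"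
    and GL: "\<And>z. z \<in> topspace ?AB \<Longrightarrow> G (?Q z) = L z"
    by (rule quotient_map_lift_exists[OF _ L]) (use fib in auto)
  have GL': "G (a, q b) = L (a, b)" if "a \<in> topspace A" "b \<in> topspace B" for a b
    using GL[of "(a, b)"] that by simp
  have pre: "\<exists>b\<in>topspace B. s = q b" if "s \<in> topspace S" for s
    using that unfolding q(2)[symmetric] by blast
  have "p (G (a, s)) = F (a, s)" if "a \<in> topspace A" "s \<in> topspace S" for a s
  proof -
    from pre[OF that(2)] obtain b where b: "b \<in> topspace B" "s = q b" ..
    show ?thesis using GL'[OF that(1) b(1)] pL[OF that(1) b(1)] b(2) by simp
  qed
  moreover have "G (a, s0) = g a" if "a \<in> topspace A" for a
    using GL'[OF that B(3)] Lb0[OF that] q(3) by simp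
  moreover have "G (a0, s) = h s" if "s \<in> topspace S" for s
  proof -
    from pre[OF that] obtain b where b: "b \<in> topspace B" "s = q b" ..
    show ?thesis using GL'[OF A(2) b(1)] La0[OF b(1)] b(2) by simp
  qed
  ultimately show ?thesis using G by (intro exI[of _ G] conjI ballI)
qed

section \<open>Based homotopies\<close>

lemma based_homotopic_iff:
  assumes "s0 \<in> topspace S"
  shows "based_homotopic S s0 X x0 f g \<longleftrightarrow>
    (\<exists>h. continuous_map (strip {0..1} S) X h \<and> (\<forall>s\<in>topspace S. h (0, s) = f s) \<and>
       (\<forall>s\<in>topspace S. h (1, s) = g s) \<and> (\<forall>t\<in>{0..1}. h (t, s0) = x0))"
  unfolding based_homotopic_def by (rule homotopic_with) (use assms in simp)

lemma based_homotopic_refl: "based_homotopic S s0 X x0 f f \<longleftrightarrow> based_map S s0 X x0 f"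
  by (simp add: based_homotopic_def based_map_def)

lemma based_homotopic_sym: "based_homotopic S s0 X x0 f g \<longleftrightarrow> based_homotopic S s0 X x0 g f"
  by (simp add: based_homotopic_def homotopic_with_sym)

lemma based_homotopic_trans:
  "\<lbrakk>based_homotopic S s0 X x0 f g; based_homotopic S s0 X x0 g h\<rbrakk> \<Longrightarrow> based_homotopic S s0 X x0 f h"
  unfolding based_homotopic_def by (rule homotopic_with_trans)

lemma based_homotopic_imp_based_maps:
  assumes "based_homotopic S s0 X x0 f g"
  shows "based_map S s0 X x0 f" "based_map S s0 X x0 g"
  using homotopic_with_imp_continuous_maps[OF assms[unfolded based_homotopic_def]]
    homotopic_with_imp_property[OF assms[unfolded based_homotopic_def]]
  by (simp_all add: based_map_def)

lemma based_homotopic_cong: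
  assumes "based_map S s0 X x0 f" "s0 \<in> topspace S" "\<And>s. s \<in> topspace S \<Longrightarrow> f s = g s"
  shows "based_homotopic S s0 X x0 f g"
  unfolding based_homotopic_def
  by (rule homotopic_with_equal) (use assms in \<open>auto simp: based_map_def\<close>)

lemma based_map_compose:
  assumes "based_map S s0 X x0 f" "based_map X x0 Y y0 g"
  shows "based_map S s0 Y y0 (g \<circ> f)"
  using assms by (auto simp: based_map_def intro: continuous_map_compose)

lemma based_homotopic_compose:
  assumes "based_homotopic S s0 X x0 f f'" "based_map X x0 Y y0 g"
  shows "based_homotopic S s0 Y y0 (g \<circ> f) (g \<circ> f')"
  using assms unfolding based_homotopic_def based_map_def
  by (auto intro: homotopic_with_compose_continuous_map_left)

text \<open>The track of the base point under the lifted homotopy lifts a constant path, so it is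
  constant and the lifted homotopy is again based.\<close>

lemma covering_lift_based_homotopy:
  assumes cov: "covering_map X' X p" and p: "p x0' = x0" and s0: "s0 \<in> topspace S"
    and f: "based_map S s0 X' x0' f" and hom: "based_homotopic S s0 X x0 (p \<circ> f) g"
  shows "\<exists>g'. based_homotopic S s0 X' x0' f g' \<and> (\<forall>s\<in>topspace S. p (g' s) = g s)"
proof -
  obtain H where H: "continuous_map (strip {0..1} S) X H"
    and H0: "\<forall>s\<in>topspace S. H (0, s) = (p \<circ> f) s" and H1: "\<forall>s\<in>topspace S. H (1, s) = g s"
    and Hs: "\<forall>t\<in>{0..1}. H (t, s0) = x0"
    using hom unfolding based_homotopic_iff[OF s0] by (elim exE conjE)
  obtain K where K: "continuous_map (strip {0..1} S) X' K"
    and K0: "\<forall>s\<in>topspace S. K (0, s) = f s"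
    and pK: "\<forall>t\<in>{0..1}. \<forall>s\<in>topspace S. p (K (t, s)) = H (t, s)"
    using covering_lift_homotopy[OF cov H, of f] f H0 by (auto simp: based_map_def)
  have "K (t, s0) = x0'" if "t \<in> {0..1}" for t
  proof (rule covering_lift_unique[OF cov _ continuous_map_strip_track[OF K s0], where ?y0.0 = 0])
    show "connected_space (top_of_set {0..1::real})"
      by (simp add: connected_space_subtopology)
    have "x0' \<in> topspace X'"
      using f s0 by (auto simp: based_map_def continuous_map_def)
    then show "continuous_map (top_of_set {0..1}) X' (\<lambda>t::real. x0')" by simp
  qed (use that s0 Hs pK p K0 f in \<open>simp_all add: based_map_def\<close>)
  then have "based_homotopic S s0 X' x0' f (\<lambda>s. K (1, s))"
    using K K0 unfolding based_homotopic_iff[OF s0] by (intro exI[of _ K]) simp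
  with H1 pK show ?thesis by (intro exI[of _ "\<lambda>s. K (1, s)"]) simp
qed

text \<open>The lifted homotopy from \<open>f\<close> ends at some lift of \<open>p \<circ> g\<close>, which is \<open>g\<close> itself because
  it has the same value at the base point.\<close>

lemma covering_reflects_based_homotopy:
  assumes cov: "covering_map X' X p" and p: "p x0' = x0"
    and S: "connected_space S" "s0 \<in> topspace S"
    and f: "based_map S s0 X' x0' f" and g: "based_map S s0 X' x0' g"
    and hom: "based_homotopic S s0 X x0 (p \<circ> f) (p \<circ> g)"
  shows "based_homotopic S s0 X' x0' f g"
proof -
  obtain g' where fg': "based_homotopic S s0 X' x0' f g'"
    and pg': "\<forall>s\<in>topspace S. p (g' s) = (p \<circ> g) s"
    using covering_lift_based_homotopy[OF cov p S(2) f hom] by (elim exE conjE)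
  have g': "based_map S s0 X' x0' g'"
    using based_homotopic_imp_based_maps[OF fg'] by simp
  have "g' s = g s" if "s \<in> topspace S" for s
    by (rule covering_lift_unique[OF cov S(1) _ _ _ S(2) _ that])
      (use g g' pg' in \<open>auto simp: based_map_def\<close>)
  then have "based_homotopic S s0 X' x0' g' g"
    by (rule based_homotopic_cong[OF g' S(2)])
  with fg' show ?thesis by (rule based_homotopic_trans)
qed

text \<open>Both \<^const>\<open>sphere_mult\<close> and \<^const>\<open>whitehead_map\<close> have this form: the domain is cut along a
  closed set \<open>c = d\<close>, which \<open>q\<close> and \<open>r\<close> collapse to the base points of two other spaces. Homotopy
  invariance of both operations, and (with constant homotopies) their continuity, follow.\<close>

lemma based_homotopic_glue:
  assumes c: "continuous_map S euclideanreal c" "continuous_map S euclideanreal d"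
    and q: "continuous_map (subtopology S {x \<in> topspace S. c x \<le> d x}) S1 q"
    and r: "continuous_map (subtopology S {x \<in> topspace S. d x \<le> c x}) S2 r"
    and q1: "\<And>x. \<lbrakk>x \<in> topspace S; c x = d x\<rbrakk> \<Longrightarrow> q x = s1"
    and r2: "\<And>x. \<lbrakk>x \<in> topspace S; c x = d x\<rbrakk> \<Longrightarrow> r x = s2"
    and s0: "s0 \<in> topspace S" "c s0 = d s0"
    and hom1: "based_homotopic S1 s1 X x0 f f'" and hom2: "based_homotopic S2 s2 X x0 g g'"
  shows "based_homotopic S s0 X x0 (\<lambda>x. if c x \<le> d x then f (q x) else g (r x))
           (\<lambda>x. if c x \<le> d x then f' (q x) else g' (r x))"
proof -
  obtain H where H: "continuous_map (strip {0..1} S1) X H" "\<forall>x. H (0, x) = f x"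
    "\<forall>x. H (1, x) = f' x" "\<forall>t\<in>{0..1}. H (t, s1) = x0"
    using hom1 unfolding based_homotopic_def homotopic_with_def by (elim exE conjE)
  obtain K where K: "continuous_map (strip {0..1} S2) X K" "\<forall>x. K (0, x) = g x"
    "\<forall>x. K (1, x) = g' x" "\<forall>t\<in>{0..1}. K (t, s2) = x0"
    using hom2 unfolding based_homotopic_def homotopic_with_def by (elim exE conjE)
  let ?Z = "strip {0..1} S"
  let ?h = "\<lambda>z. if c (snd z) \<le> d (snd z) then H (fst z, q (snd z)) else K (fst z, r (snd z))"
  have sub: "subtopology ?Z {z \<in> topspace ?Z. snd z \<in> E} = strip {0..1} (subtopology S E)"
    if "E \<subseteq> topspace S" for E
  proof -
    have "{z \<in> topspace ?Z. snd z \<in> E} = {0..1} \<times> E" using that by auto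
    then show ?thesis by (simp add: subtopology_Times subtopology_subtopology)
  qed
  have push: "continuous_map (subtopology ?Z {z \<in> topspace ?Z. snd z \<in> E}) X (\<lambda>z. M (fst z, w (snd z)))"
    if "E \<subseteq> topspace S" "continuous_map (subtopology S E) W w" "continuous_map (strip {0..1} W) X M"
    for E W w M
  proof -
    have "continuous_map (strip {0..1} (subtopology S E)) (strip {0..1} W) (\<lambda>z. (fst z, w (snd z)))"
      using continuous_map_compose[OF continuous_map_snd that(2)]
      by (simp add: continuous_map_pairwise o_def continuous_map_fst)
    from continuous_map_compose[OF this that(3)] show ?thesis
      unfolding sub[OF that(1)] by (simp add: o_def)
  qed
  have "continuous_map ?Z X ?h"
  proof (rule continuous_map_cases_le)
    show "continuous_map ?Z euclideanreal (\<lambda>z. c (snd z))" "continuous_map ?Z euclideanreal (\<lambda>z. d (snd z))"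
      using continuous_map_compose[OF continuous_map_snd c(1)]
        continuous_map_compose[OF continuous_map_snd c(2)] by (simp_all add: o_def)
    have eq: "{z \<in> topspace ?Z. P (snd z)} = {z \<in> topspace ?Z. snd z \<in> {x \<in> topspace S. P x}}" for P
      by auto
    show "continuous_map (subtopology ?Z {z \<in> topspace ?Z. c (snd z) \<le> d (snd z)}) X
        (\<lambda>z. H (fst z, q (snd z)))"
      unfolding eq[of "\<lambda>x. c x \<le> d x"] by (rule push[OF _ q H(1)]) auto
    show "continuous_map (subtopology ?Z {z \<in> topspace ?Z. d (snd z) \<le> c (snd z)}) X
        (\<lambda>z. K (fst z, r (snd z)))"
      unfolding eq[of "\<lambda>x. d x \<le> c x"] by (rule push[OF _ r K(1)]) auto
  qed (use q1 r2 H(4) K(4) in auto)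
  then show ?thesis
    unfolding based_homotopic_def homotopic_with_def
    using H K q1[OF s0] s0(2) by (intro exI[of _ ?h]) simp
qed

section \<open>Maps on wedges\<close>

text \<open>For open \<open>U\<close> the preimage is the intersection of the preimages under \<open>f\<close> and \<open>g\<close> if
  \<open>x0 \<in> U\<close>, and their union otherwise. Pasting along closed sets would not do for a wedge
  \<open>A \<or> S\<close>, since the axis \<open>{a0} \<times> S\<close> need not be closed in \<open>A \<times> S\<close>.\<close>

lemma continuous_map_wedge_join:
  assumes f: "continuous_map Z X f" and g: "continuous_map Z X g"
    and x0: "\<And>z. z \<in> topspace Z \<Longrightarrow> f z = x0 \<or> g z = x0"
  shows "continuous_map Z X (\<lambda>z. if g z = x0 then f z else g z)"
  unfolding continuous_map_def
proof (intro conjI allI impI)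
  show "(\<lambda>z. if g z = x0 then f z else g z) \<in> topspace Z \<rightarrow> topspace X"
    using f g by (auto simp: continuous_map_def)
  fix U assume U: "openin X U"
  have fU: "openin Z {z \<in> topspace Z. f z \<in> U}" and gU: "openin Z {z \<in> topspace Z. g z \<in> U}"
    using f g U by (auto simp: continuous_map_def)
  have "{z \<in> topspace Z. (if g z = x0 then f z else g z) \<in> U} =
    (if x0 \<in> U then {z \<in> topspace Z. f z \<in> U} \<inter> {z \<in> topspace Z. g z \<in> U}
     else {z \<in> topspace Z. f z \<in> U} \<union> {z \<in> topspace Z. g z \<in> U})"
  proof (intro Set.set_eqI)
    fix z
    show "z \<in> {z \<in> topspace Z. (if g z = x0 then f z else g z) \<in> U} \<longleftrightarrow>
      z \<in> (if x0 \<in> U then {z \<in> topspace Z. f z \<in> U} \<inter> {z \<in> topspace Z. g z \<in> U}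
     else {z \<in> topspace Z. f z \<in> U} \<union> {z \<in> topspace Z. g z \<in> U})"
      using x0[of z] by (cases "z \<in> topspace Z") auto
  qed
  then show "openin Z {z \<in> topspace Z. (if g z = x0 then f z else g z) \<in> U}"
    using openin_Int[OF fU gU] openin_Un[OF fU gU] by presburger
qed

lemma topspace_wedge:
  "topspace (wedge A a0 S s0) = (topspace A \<times> topspace S) \<inter> (topspace A \<times> {s0} \<union> {a0} \<times> topspace S)"
  by (simp add: wedge_def)

lemma based_homotopic_wedge_map:
  assumes f: "based_map A a0 X x0 f" and hom: "based_homotopic S s0 X x0 g g'"
    and a0: "a0 \<in> topspace A" and s0: "s0 \<in> topspace S"
  shows "based_homotopic (wedge A a0 S s0) (a0, s0) X x0 (wedge_map s0 f g) (wedge_map s0 f g')"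
proof -
  obtain H where H: "continuous_map (strip {0..1} S) X H" "\<forall>x. H (0, x) = g x"
    "\<forall>x. H (1, x) = g' x" and Hs: "\<forall>t\<in>{0..1}. H (t, s0) = x0"
    using hom unfolding based_homotopic_def homotopic_with_def by (elim exE conjE)
  let ?W = "wedge A a0 S s0"
  let ?Z = "strip {0..1} ?W"
  let ?f = "\<lambda>z. f (fst (snd z))" and ?g = "\<lambda>z. H (fst z, snd (snd z))"
  let ?h = "\<lambda>z. if ?g z = x0 then ?f z else ?g z"
  have gs: "g s0 = x0" "g' s0 = x0"
    using bspec[OF Hs, of 0] bspec[OF Hs, of 1] H(2,3) by simp_all
  have fa0: "f a0 = x0" using f by (simp add: based_map_def)
  have W: "(a0, s0) \<in> topspace ?W" using a0 s0 by (simp add: topspace_wedge)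
  have fstW: "continuous_map ?W A fst" and sndW: "continuous_map ?W S snd"
    unfolding wedge_def by (simp_all add: continuous_map_from_subtopology continuous_map_fst continuous_map_snd)
  have "continuous_map ?Z X ?h"
  proof (rule continuous_map_wedge_join)
    show "continuous_map ?Z X ?f"
      using continuous_map_compose[OF continuous_map_compose[OF continuous_map_snd fstW], of X f] f
      by (simp add: based_map_def o_def)
    have "continuous_map ?Z (strip {0..1} S) (\<lambda>z. (fst z, snd (snd z)))"
      using continuous_map_compose[OF continuous_map_snd sndW]
      by (simp add: continuous_map_pairwise o_def continuous_map_fst)
    from continuous_map_compose[OF this H(1)] show "continuous_map ?Z X ?g" by (simp add: o_def)
    show "?f z = x0 \<or> ?g z = x0" if "z \<in> topspace ?Z" for z
      using that Hs fa0 by (auto simp: topspace_wedge)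
  qed
  moreover have "?h (0, w) = wedge_map s0 f g w" "?h (1, w) = wedge_map s0 f g' w" if "w \<in> topspace ?W" for w
    using that H(2,3) gs fa0 by (auto simp: topspace_wedge wedge_map_def)
  moreover have "?h (t, (a0, s0)) = x0" if "t \<in> {0..1}" for t
    using Hs fa0 that by simp
  ultimately show ?thesis
    unfolding based_homotopic_iff[OF W] by (intro exI[of _ ?h] conjI ballI)
qed

section \<open>Discs and spheres\<close>

lemma topspace_nsphere:
  "x \<in> topspace (nsphere n) \<longleftrightarrow> (\<forall>i>n. x i = 0) \<and> (\<Sum>i\<le>n. (x i)\<^sup>2) = 1"
  by (auto simp: nsphere_def topspace_Euclidean_space Suc_le_eq)

lemma topspace_disc:
  "u \<in> topspace (disc n) \<longleftrightarrow> (\<forall>i\<ge>n. u i = 0) \<and> (\<Sum>i<n. (u i)\<^sup>2) \<le> 1"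
  by (auto simp: disc_def topspace_Euclidean_space)

lemma continuous_map_into_nsphere:
  assumes "\<And>i. continuous_map Z euclideanreal (\<lambda>z. f z i)"
    and "\<And>z. z \<in> topspace Z \<Longrightarrow> f z \<in> topspace (nsphere n)"
  shows "continuous_map Z (nsphere n) f"
  using assms
  by (auto simp: nsphere continuous_map_in_subtopology continuous_map_componentwise_UNIV)

lemma disc_subtopology: "disc n = subtopology (powertop_real UNIV) (topspace (disc n))"
  by (simp add: disc_def Euclidean_space_def subtopology_subtopology)

lemma continuous_map_into_disc:
  assumes "\<And>i. continuous_map Z euclideanreal (\<lambda>z. f z i)"
    and "\<And>z. z \<in> topspace Z \<Longrightarrow> f z \<in> topspace (disc n)"
  shows "continuous_map Z (disc n) f"
  by (subst disc_subtopology)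
    (use assms in \<open>auto simp: continuous_map_in_subtopology continuous_map_componentwise_UNIV\<close>)

lemma continuous_map_disc_projection: "continuous_map (disc n) euclideanreal (\<lambda>u. u i)"
  by (subst disc_subtopology) (intro continuous_intros, simp)

lemma Hausdorff_space_nsphere: "Hausdorff_space (nsphere n)"
  unfolding nsphere
  by (intro Hausdorff_space_subtopology) (simp add: Hausdorff_space_product_topology)

text \<open>A closed subset of a cube, which is compact by Tychonoff's theorem.\<close>

lemma compact_space_disc: "compact_space (disc n)"
proof -
  let ?B = "product_topology (\<lambda>i. top_of_set {-1..1::real}) (UNIV :: nat set)"
  let ?P = "powertop_real (UNIV :: nat set)"
  have "compact_space ?B"
    by (simp add: compact_space_product_topology compact_space_subtopology)
  then have B: "compactin ?P (PiE UNIV (\<lambda>i. {-1..1}))"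
    by (simp add: compactin_PiE)
  have sum: "continuous_map ?P euclideanreal (\<lambda>u. \<Sum>i<n. (u i)\<^sup>2)"
    by (intro continuous_intros continuous_map_product_projection) auto
  have "closedin ?P ({u \<in> topspace ?P. \<forall>i\<in>{n..}. u i \<in> {0}} \<inter> {u \<in> topspace ?P. (\<Sum>i<n. (u i)\<^sup>2) \<in> {..1}})"
  proof (intro closedin_Int)
    show "closedin ?P {u \<in> topspace ?P. \<forall>i\<in>{n..}. u i \<in> {0}}"
      using closedin_Euclidean_space[of n] by (simp add: topspace_Euclidean_space Ball_def)
    show "closedin ?P {u \<in> topspace ?P. (\<Sum>i<n. (u i)\<^sup>2) \<in> {..1}}"
      by (rule closedin_continuous_map_preimage[OF sum]) simp
  qed
  moreover have "{u \<in> topspace ?P. \<forall>i\<in>{n..}. u i \<in> {0}} \<inter> {u \<in> topspace ?P. (\<Sum>i<n. (u i)\<^sup>2) \<in> {..1}}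
      = topspace (disc n)"
    by (auto simp: topspace_disc)
  ultimately have cl: "closedin ?P (topspace (disc n))" by simp
  have "topspace (disc n) \<subseteq> PiE UNIV (\<lambda>i. {-1..1})"
  proof
    fix u assume u: "u \<in> topspace (disc n)"
    have "\<bar>u i\<bar> \<le> 1" for i
    proof (cases "i < n")
      case True
      then have "(u i)\<^sup>2 \<le> (\<Sum>i<n. (u i)\<^sup>2)"
        by (intro member_le_sum) auto
      also have "\<dots> \<le> 1" using u by (simp add: topspace_disc)
      finally show ?thesis by (simp add: abs_square_le_1)
    qed (use u in \<open>simp add: topspace_disc\<close>)
    then show "u \<in> PiE UNIV (\<lambda>i. {-1..1})" by (simp add: PiE_iff abs_le_iff)
  qed
  with cl B have "compactin ?P (topspace (disc n))" by (metis closed_compactin)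
  then show ?thesis by (subst disc_subtopology) (rule compact_space_subtopology)
qed

lemma contractible_space_disc: "contractible_space (disc n)"
proof -
  let ?h = "\<lambda>(t, u). \<lambda>i. t * u i :: real"
  have zero: "(\<lambda>_. 0) \<in> topspace (disc n)" by (simp add: topspace_disc)
  have "continuous_map (strip {0..1} (disc n)) (disc n) ?h"
  proof (rule continuous_map_into_disc)
    fix i
    have "continuous_map (strip {0..1} (disc n)) euclideanreal (\<lambda>z. fst z * snd z i)"
    proof (intro continuous_intros)
      show "continuous_map (strip {0..1::real} (disc n)) euclideanreal fst"
        using continuous_map_fst continuous_map_into_fulltopology by blast
      show "continuous_map (strip {0..1::real} (disc n)) euclideanreal (\<lambda>z. snd z i)"
        using continuous_map_compose[OF continuous_map_snd continuous_map_disc_projection]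
        by (simp add: o_def)
    qed
    then show "continuous_map (strip {0..1} (disc n)) euclideanreal (\<lambda>z. ?h z i)"
      by (simp add: case_prod_unfold)
  next
    fix z assume "z \<in> topspace (strip {0..1} (disc n))"
    then obtain t u where z: "z = (t, u)" and t: "0 \<le> t" "t \<le> 1" and u: "u \<in> topspace (disc n)"
      by auto
    have "(\<Sum>i<n. (t * u i)\<^sup>2) = t\<^sup>2 * (\<Sum>i<n. (u i)\<^sup>2)"
      by (simp add: power_mult_distrib sum_distrib_left)
    also have "\<dots> \<le> 1 * 1"
      using t u by (intro mult_mono) (auto simp: topspace_disc abs_square_le_1 sum_nonneg)
    finally show "?h z \<in> topspace (disc n)" using u z by (simp add: topspace_disc)
  qed
  then have "homotopic_with (\<lambda>_. True) (disc n) (disc n) (\<lambda>_ _. 0) id"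
    unfolding homotopic_with_def by (intro exI[of _ ?h]) auto
  then show ?thesis
    unfolding contractible_space_def by (blast intro: homotopic_with_symD)
qed

lemma sphere_base_in_nsphere: "sphere_base \<in> topspace (nsphere n)"
  using in_topspace_nsphere by (simp add: sphere_base_def)

lemma sum_sphere_base: "n \<ge> 1 \<Longrightarrow> (\<Sum>i<n. (sphere_base i)\<^sup>2) = 1"
  by (simp add: sphere_base_def if_distrib[of "\<lambda>x. x\<^sup>2"] cong: if_cong)

lemma sphere_base_in_disc: "n \<ge> 1 \<Longrightarrow> sphere_base \<in> topspace (disc n)"
  by (simp add: topspace_disc sum_sphere_base) (simp add: sphere_base_def)

lemma sum_disc_collapse:
  "(\<Sum>i\<le>n. (disc_collapse n u i)\<^sup>2) =
     (2 * (\<Sum>i<n. (u i)\<^sup>2) - 1)\<^sup>2 + 4 * (sqrt (1 - (\<Sum>i<n. (u i)\<^sup>2)))\<^sup>2 * (\<Sum>i<n. (u i)\<^sup>2)"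
proof -
  have "(disc_collapse n u (Suc i))\<^sup>2 = 4 * (sqrt (1 - (\<Sum>i<n. (u i)\<^sup>2)))\<^sup>2 * (u i)\<^sup>2" for i
    by (simp add: disc_collapse_def Let_def power_mult_distrib)
  moreover have "disc_collapse n u 0 = 2 * (\<Sum>i<n. (u i)\<^sup>2) - 1"
    by (simp add: disc_collapse_def Let_def)
  ultimately show ?thesis
    by (simp add: sum.atMost_shift flip: sum_distrib_left)
qed

lemma continuous_map_disc_collapse: "continuous_map (disc n) (nsphere n) (disc_collapse n)"
proof (rule continuous_map_into_nsphere)
  show "continuous_map (disc n) euclideanreal (\<lambda>u. disc_collapse n u i)" for i
  proof -
    consider "i = 0" | "i = 1" | "i > 1" by linarith
    then show ?thesis
      by cases (auto simp: disc_collapse_def Let_def intro!: continuous_intros continuous_map_disc_projection)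
  qed
  show "disc_collapse n u \<in> topspace (nsphere n)" if u: "u \<in> topspace (disc n)" for u
  proof -
    have "disc_collapse n u i = 0" if "i > n" for i
      using u that by (auto simp: topspace_disc disc_collapse_def Let_def)
    moreover have "(\<Sum>i<n. (u i)\<^sup>2) \<le> 1" using u by (simp add: topspace_disc)
    then have "(\<Sum>i\<le>n. (disc_collapse n u i)\<^sup>2) = 1"
      unfolding sum_disc_collapse by (simp add: power2_eq_square algebra_simps)
    ultimately show ?thesis by (simp add: topspace_nsphere)
  qed
qed

lemma disc_collapse_boundary:
  "(\<Sum>i<n. (u i)\<^sup>2) = 1 \<Longrightarrow> disc_collapse n u = sphere_base"
  by (auto simp: disc_collapse_def Let_def sphere_base_def fun_eq_iff)

text \<open>Surjectivity makes the sphere a quotient of the disc, and gives its connectedness for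
  \<open>n \<ge> 1\<close>.\<close>

lemma disc_collapse_surj:
  assumes n: "n \<ge> 1"
  shows "disc_collapse n ` topspace (disc n) = topspace (nsphere n)"
proof
  show "disc_collapse n ` topspace (disc n) \<subseteq> topspace (nsphere n)"
    using continuous_map_disc_collapse continuous_map_image_subset_topspace by blast
  show "topspace (nsphere n) \<subseteq> disc_collapse n ` topspace (disc n)"
  proof
    fix x assume x: "x \<in> topspace (nsphere n)"
    then have x0: "x i = 0" if "i > n" for i using that by (simp add: topspace_nsphere)
    have sum: "(x 0)\<^sup>2 + (\<Sum>i<n. (x (Suc i))\<^sup>2) = 1"
      using x by (simp add: topspace_nsphere sum.atMost_shift)
    have "(x 0)\<^sup>2 \<le> 1" using sum sum_nonneg[of "{..<n}" "\<lambda>i. (x (Suc i))\<^sup>2"] by simp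
    then have le: "x 0 \<le> 1" by (simp add: abs_square_le_1 abs_le_iff)
    show "x \<in> disc_collapse n ` topspace (disc n)"
    proof (cases "x 0 = 1")
      case True
      with sum have "\<forall>i\<in>{..<n}. (x (Suc i))\<^sup>2 = 0"
        by (subst sum_nonneg_eq_0_iff[symmetric]) auto
      then have "x (Suc i) = 0" for i
        using x0[of "Suc i"] by (cases "i < n") auto
      then have "x = sphere_base"
        using True by (auto simp: sphere_base_def fun_eq_iff gr0_conv_Suc)
      then show ?thesis
        using disc_collapse_boundary[OF sum_sphere_base[OF n]] sphere_base_in_disc[OF n] by force
    next
      case False
      define s where "s = sqrt ((1 - x 0) / 2)"
      have s: "s > 0" "s\<^sup>2 = (1 - x 0) / 2" using le False by (auto simp: s_def)
      \<comment> \<open>The first coordinate forces \<open>\<bar>u\<bar>\<^sup>2 = (1 + x 0) / 2\<close>, and so \<open>s\<close> is the square root in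
        the definition of the collapse.\<close>
      define u where "u = (\<lambda>j. (if j = 0 then - x 1 else x (Suc j)) / (2 * s))"
      have "(u j)\<^sup>2 = (x (Suc j))\<^sup>2 / (4 * s\<^sup>2)" for j
        by (simp add: u_def power_divide power_mult_distrib)
      then have "(\<Sum>i<n. (u i)\<^sup>2) = (\<Sum>i<n. (x (Suc i))\<^sup>2) / (4 * s\<^sup>2)"
        by (simp add: sum_divide_distrib)
      also have "(\<Sum>i<n. (x (Suc i))\<^sup>2) = (1 - x 0) * (1 + x 0)"
        using sum by (simp add: power2_eq_square algebra_simps)
      also have "(1 - x 0) * (1 + x 0) / (4 * s\<^sup>2) = (1 + x 0) / 2"
        unfolding s(2) using False by (simp add: field_simps)
      finally have r2: "(\<Sum>i<n. (u i)\<^sup>2) = (1 + x 0) / 2" .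
      have "1 - (1 + x 0) / 2 = (1 - x 0) / 2" by (simp add: field_simps)
      then have "sqrt (1 - (1 + x 0) / 2) = s" unfolding s_def by simp
      then have "disc_collapse n u =
          (\<lambda>i. if i = 0 then x 0 else if i = 1 then - 2 * s * u 0 else 2 * s * u (i - 1))"
        unfolding disc_collapse_def Let_def r2 by (simp add: fun_eq_iff field_simps)
      also have "\<dots> = x"
        using s(1) by (auto simp: u_def fun_eq_iff)
      finally have "disc_collapse n u = x" .
      moreover have "u i = 0" if "i \<ge> n" for i
        using n x0 that by (simp add: u_def)
      then have "u \<in> topspace (disc n)"
        using le by (simp add: topspace_disc r2)
      ultimately show ?thesis by blast
    qed
  qed
qed

lemma connected_space_nsphere:
  assumes "n \<ge> 1"
  shows "connected_space (nsphere n)"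
proof -
  have "connectedin (nsphere n) (disc_collapse n ` topspace (disc n))"
    by (rule connectedin_continuous_map_image[OF continuous_map_disc_collapse])
      (simp add: connectedin_topspace contractible_imp_connected_space contractible_space_disc)
  then show ?thesis
    by (simp add: disc_collapse_surj[OF assms] connectedin_topspace)
qed

lemma continuous_map_pinch:
  assumes "n \<ge> 1"
  shows "continuous_map (nsphere n) (nsphere n) pinch"
proof (rule continuous_map_into_nsphere)
  show "continuous_map (nsphere n) euclideanreal (\<lambda>x. pinch x i)" for i
  proof -
    consider "i = 0" | "i = 1" | "i > 1" by linarith
    then show ?thesis
      by cases (auto simp: pinch_def intro!: continuous_intros continuous_map_nsphere_projection)
  qed
  show "pinch x \<in> topspace (nsphere n)" if x: "x \<in> topspace (nsphere n)" for x
  proof -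
    obtain k where k: "n = Suc k" using assms by (cases n) auto
    have split: "(\<Sum>i\<le>n. g i) = g 0 + g 1 + (\<Sum>i<k. g (Suc (Suc i)))" for g :: "nat \<Rightarrow> real"
      by (simp add: k sum.atMost_shift sum.lessThan_Suc_shift del: sum.lessThan_Suc)
    define R where "R = (\<Sum>i<k. (x (Suc (Suc i)))\<^sup>2)"
    have 1: "(x 0)\<^sup>2 + (x 1)\<^sup>2 + R = 1"
      using x by (simp add: topspace_nsphere split R_def)
    have "(\<Sum>i\<le>n. (pinch x i)\<^sup>2) = (1 - 2 * (x 1)\<^sup>2)\<^sup>2 + (2 * x 1 * x 0)\<^sup>2 + 4 * (x 1)\<^sup>2 * R"
      by (simp add: split pinch_def R_def power_mult_distrib sum_distrib_left)
    also have "\<dots> = 1 - 4 * (x 1)\<^sup>2 * (1 - ((x 0)\<^sup>2 + (x 1)\<^sup>2 + R))"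
      by (simp add: power2_eq_square algebra_simps)
    finally have "(\<Sum>i\<le>n. (pinch x i)\<^sup>2) = 1" using 1 by simp
    then show ?thesis
      using x assms by (simp add: topspace_nsphere) (simp add: pinch_def)
  qed
qed

lemma pinch_equator: "x 1 = 0 \<Longrightarrow> pinch x = sphere_base"
  by (auto simp: pinch_def sphere_base_def)


section \<open>The decomposition of the sphere behind Whitehead products\<close>

text \<open>The vectors \<open>u\<close> and \<open>v\<close> of the definition of \<^const>\<open>whitehead_map\<close>, named here so that
  their continuity can be stated.\<close>

definition whitehead_u :: "nat \<Rightarrow> (nat \<Rightarrow> real) \<Rightarrow> nat \<Rightarrow> real" where
  "whitehead_u m x = (\<lambda>i. if i = 0 then (x 0 - x m) / sqrt 2 else if i < m then x i else 0)"

definition whitehead_v :: "nat \<Rightarrow> nat \<Rightarrow> (nat \<Rightarrow> real) \<Rightarrow> nat \<Rightarrow> real" where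
  "whitehead_v m l x = (\<lambda>i. if i = 0 then (x 0 + x m) / sqrt 2 else if i < l then x (m + i) else 0)"

definition radius :: "nat \<Rightarrow> (nat \<Rightarrow> real) \<Rightarrow> real" where
  "radius n u = sqrt (\<Sum>i<n. (u i)\<^sup>2)"

lemma whitehead_map_eq:
  "whitehead_map m l f g =
     (\<lambda>x. if radius m (whitehead_u m x) \<le> radius l (whitehead_v m l x)
           then f (disc_collapse m (\<lambda>i. whitehead_u m x i / radius l (whitehead_v m l x)))
           else g (disc_collapse l (\<lambda>i. whitehead_v m l x i / radius m (whitehead_u m x))))"
  by (simp add: fun_eq_iff whitehead_map_def whitehead_u_def whitehead_v_def radius_def Let_def)

lemma radius_nonneg: "radius n u \<ge> 0"
  by (simp add: radius_def sum_nonneg)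

lemma radius_power2: "(radius n u)\<^sup>2 = (\<Sum>i<n. (u i)\<^sup>2)"
  by (simp add: radius_def sum_nonneg)

text \<open>A rotation preserves the norm. In particular the larger of the two radii is positive, so
  that the radial projection divides by a nonzero number.\<close>

lemma whitehead_uv_sphere:
  assumes "m \<ge> 1" "l \<ge> 1" "x \<in> topspace (nsphere (m + l - 1))"
  shows "(radius m (whitehead_u m x))\<^sup>2 + (radius l (whitehead_v m l x))\<^sup>2 = 1"
proof -
  obtain m' l' where ml: "m = Suc m'" "l = Suc l'" using assms by (metis Suc_le_D One_nat_def)
  have "(\<Sum>i<m. (whitehead_u m x i)\<^sup>2) = (x 0 - x m)\<^sup>2 / 2 + (\<Sum>i<m'. (x (Suc i))\<^sup>2)"
    by (simp add: ml sum.lessThan_Suc_shift whitehead_u_def power_divide del: sum.lessThan_Suc)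
  moreover have "(\<Sum>i<l. (whitehead_v m l x i)\<^sup>2) = (x 0 + x m)\<^sup>2 / 2 + (\<Sum>i<l'. (x (m + Suc i))\<^sup>2)"
    by (simp add: ml sum.lessThan_Suc_shift whitehead_v_def power_divide del: sum.lessThan_Suc)
  moreover have "(\<Sum>i<m + l. (x i)\<^sup>2) = (\<Sum>i<m. (x i)\<^sup>2) + (\<Sum>i<l. (x (m + i))\<^sup>2)"
    by (induction l) simp_all
  moreover have "(\<Sum>i<m. (x i)\<^sup>2) = (x 0)\<^sup>2 + (\<Sum>i<m'. (x (Suc i))\<^sup>2)"
    "(\<Sum>i<l. (x (m + i))\<^sup>2) = (x m)\<^sup>2 + (\<Sum>i<l'. (x (m + Suc i))\<^sup>2)"
    by (simp_all add: ml sum.lessThan_Suc_shift del: sum.lessThan_Suc)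
  moreover have "(\<Sum>i<m + l. (x i)\<^sup>2) = 1"
  proof -
    have "{..<m + l} = {..m + l - 1}" using assms by auto
    with assms(3) show ?thesis by (simp add: topspace_nsphere)
  qed
  moreover have "(x 0 - x m)\<^sup>2 / 2 + (x 0 + x m)\<^sup>2 / 2 = (x 0)\<^sup>2 + (x m)\<^sup>2"
    by (simp add: power2_eq_square field_simps)
  ultimately show ?thesis unfolding radius_power2 by linarith
qed

lemma continuous_map_whitehead_u: "continuous_map (nsphere k) euclideanreal (\<lambda>x. whitehead_u m x i)"
  by (auto simp: whitehead_u_def intro!: continuous_intros continuous_map_nsphere_projection)

lemma continuous_map_whitehead_v: "continuous_map (nsphere k) euclideanreal (\<lambda>x. whitehead_v m l x i)"
  by (auto simp: whitehead_v_def intro!: continuous_intros continuous_map_nsphere_projection)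

lemma continuous_map_radius:
  assumes "\<And>i. continuous_map Z euclideanreal (\<lambda>x. w x i)"
  shows "continuous_map Z euclideanreal (\<lambda>x. radius n (w x))"
  unfolding radius_def by (intro continuous_intros assms) auto

lemma continuous_map_radial_collapse:
  assumes w: "\<And>i. continuous_map Z euclideanreal (\<lambda>x. w x i)" and c: "continuous_map Z euclideanreal c"
    and w0: "\<And>x i. i \<ge> n \<Longrightarrow> w x i = 0"
    and le: "\<And>x. x \<in> topspace Z \<Longrightarrow> radius n (w x) \<le> c x" and pos: "\<And>x. x \<in> topspace Z \<Longrightarrow> c x > 0"
  shows "continuous_map Z (nsphere n) (\<lambda>x. disc_collapse n (\<lambda>i. w x i / c x))"
proof -
  have "continuous_map Z (disc n) (\<lambda>x i. w x i / c x)"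
  proof (rule continuous_map_into_disc)
    show "continuous_map Z euclideanreal (\<lambda>x. w x i / c x)" for i
      using w c pos by (intro continuous_intros) force+
    show "(\<lambda>i. w x i / c x) \<in> topspace (disc n)" if x: "x \<in> topspace Z" for x
    proof -
      have "(\<Sum>i<n. (w x i / c x)\<^sup>2) = (radius n (w x) / c x)\<^sup>2"
        by (simp add: power_divide radius_power2 sum_divide_distrib)
      also have "\<dots> \<le> 1"
        using le[OF x] pos[OF x] radius_nonneg[of n "w x"] by (simp add: abs_square_le_1)
      finally show ?thesis using w0 by (simp add: topspace_disc)
    qed
  qed
  from continuous_map_compose[OF this continuous_map_disc_collapse] show ?thesis
    by (simp add: o_def)
qed

lemma disc_collapse_radial:
  assumes "radius n u = c" "c > 0"
  shows "disc_collapse n (\<lambda>i. u i / c) = sphere_base"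
proof (rule disc_collapse_boundary)
  have "(\<Sum>i<n. (u i / c)\<^sup>2) = (radius n u / c)\<^sup>2"
    by (simp add: power_divide radius_power2 sum_divide_distrib)
  then show "(\<Sum>i<n. (u i / c)\<^sup>2) = 1" using assms by simp
qed

section \<open>Homotopy classes\<close>

abbreviation based_sphere_map :: "nat \<Rightarrow> 'a topology \<Rightarrow> 'a \<Rightarrow> ((nat \<Rightarrow> real) \<Rightarrow> 'a) \<Rightarrow> bool"
  where "based_sphere_map n \<equiv> based_map (nsphere n) sphere_base"

abbreviation sphere_homotopic ::
    "nat \<Rightarrow> 'a topology \<Rightarrow> 'a \<Rightarrow> ((nat \<Rightarrow> real) \<Rightarrow> 'a) \<Rightarrow> ((nat \<Rightarrow> real) \<Rightarrow> 'a) \<Rightarrow> bool"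
  where "sphere_homotopic n \<equiv> based_homotopic (nsphere n) sphere_base"

lemma mem_sphere_class: "\<beta> \<in> sphere_class n X x0 \<alpha> \<longleftrightarrow> sphere_homotopic n X x0 \<alpha> \<beta>"
  by (simp add: sphere_class_def)

lemma sphere_class_cong:
  assumes "sphere_homotopic n X x0 \<alpha> \<beta>"
  shows "sphere_class n X x0 \<alpha> = sphere_class n X x0 \<beta>"
  unfolding sphere_class_def
proof (rule Collect_cong)
  show "sphere_homotopic n X x0 \<alpha> \<gamma> \<longleftrightarrow> sphere_homotopic n X x0 \<beta> \<gamma>" for \<gamma>
    using assms assms[unfolded based_homotopic_sym[of _ _ _ _ \<alpha> \<beta>]] by (meson based_homotopic_trans)
qed

lemma sphere_class_eq_iff:
  assumes "based_sphere_map n X x0 \<beta>"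
  shows "sphere_class n X x0 \<alpha> = sphere_class n X x0 \<beta> \<longleftrightarrow> sphere_homotopic n X x0 \<alpha> \<beta>"
  using sphere_class_cong mem_sphere_class[of \<beta> n X x0 \<alpha>] mem_sphere_class[of \<beta> n X x0 \<beta>]
    assms[folded based_homotopic_refl] by metis

lemma carrier_homotopy_group:
  "c \<in> carrier (homotopy_group n X x0) \<longleftrightarrow>
     (\<exists>\<alpha>. based_sphere_map n X x0 \<alpha> \<and> c = sphere_class n X x0 \<alpha>)"
  by (auto simp: homotopy_group_def)

lemma one_homotopy_group: "\<one>\<^bsub>homotopy_group n X x0\<^esub> = sphere_class n X x0 (\<lambda>_. x0)"
  by (simp add: homotopy_group_def)

text \<open>Operations on homotopy classes are defined as unions over all representatives; homotopy
  invariance of \<open>\<Phi>\<close> says that all members of the union are the same class.\<close>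

lemma UN_sphere_class:
  assumes "based_sphere_map n X x0 \<alpha>"
    and "\<And>\<alpha>'. sphere_homotopic n X x0 \<alpha> \<alpha>' \<Longrightarrow> sphere_homotopic k Y y0 (\<Phi> \<alpha>) (\<Phi> \<alpha>')"
  shows "(\<Union>\<alpha>'\<in>sphere_class n X x0 \<alpha>. sphere_class k Y y0 (\<Phi> \<alpha>')) = sphere_class k Y y0 (\<Phi> \<alpha>)"
proof -
  have "sphere_class k Y y0 (\<Phi> \<alpha>') = sphere_class k Y y0 (\<Phi> \<alpha>)" if "\<alpha>' \<in> sphere_class n X x0 \<alpha>" for \<alpha>'
    using sphere_class_cong[OF assms(2)] that by (simp add: mem_sphere_class)
  moreover have "\<alpha> \<in> sphere_class n X x0 \<alpha>"
    using assms(1) by (simp add: mem_sphere_class based_homotopic_refl)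
  ultimately show ?thesis by (metis (no_types, lifting) SUP_eq_const empty_iff)
qed

lemma UN_sphere_class2:
  assumes \<alpha>: "based_sphere_map n X x0 \<alpha>" and \<beta>: "based_sphere_map l X x0 \<beta>"
    and \<Phi>: "\<And>\<alpha>' \<beta>'. \<lbrakk>sphere_homotopic n X x0 \<alpha> \<alpha>'; sphere_homotopic l X x0 \<beta> \<beta>'\<rbrakk>
            \<Longrightarrow> sphere_homotopic k Y y0 (\<Phi> \<alpha> \<beta>) (\<Phi> \<alpha>' \<beta>')"
  shows "(\<Union>\<alpha>'\<in>sphere_class n X x0 \<alpha>. \<Union>\<beta>'\<in>sphere_class l X x0 \<beta>. sphere_class k Y y0 (\<Phi> \<alpha>' \<beta>'))
    = sphere_class k Y y0 (\<Phi> \<alpha> \<beta>)"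
proof -
  have rfl: "sphere_homotopic n X x0 \<alpha> \<alpha>" "sphere_homotopic l X x0 \<beta> \<beta>"
    using \<alpha> \<beta> by (simp_all add: based_homotopic_refl)
  have "(\<Union>\<beta>'\<in>sphere_class l X x0 \<beta>. sphere_class k Y y0 (\<Phi> \<alpha>' \<beta>')) = sphere_class k Y y0 (\<Phi> \<alpha>' \<beta>)"
    if "\<alpha>' \<in> sphere_class n X x0 \<alpha>" for \<alpha>'
  proof (rule UN_sphere_class[OF \<beta>])
    have \<alpha>': "sphere_homotopic n X x0 \<alpha> \<alpha>'" using that by (simp add: mem_sphere_class)
    fix \<beta>' assume "sphere_homotopic l X x0 \<beta> \<beta>'"
    from \<Phi>[OF \<alpha>' this] \<Phi>[OF \<alpha>' rfl(2)] show "sphere_homotopic k Y y0 (\<Phi> \<alpha>' \<beta>) (\<Phi> \<alpha>' \<beta>')"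
      by (meson based_homotopic_sym based_homotopic_trans)
  qed
  then have "(\<Union>\<alpha>'\<in>sphere_class n X x0 \<alpha>. \<Union>\<beta>'\<in>sphere_class l X x0 \<beta>. sphere_class k Y y0 (\<Phi> \<alpha>' \<beta>'))
    = (\<Union>\<alpha>'\<in>sphere_class n X x0 \<alpha>. sphere_class k Y y0 (\<Phi> \<alpha>' \<beta>))"
    by (rule SUP_cong[OF refl])
  also have "\<dots> = sphere_class k Y y0 (\<Phi> \<alpha> \<beta>)"
    by (rule UN_sphere_class[OF \<alpha>, where \<Phi> = "\<lambda>\<alpha>. \<Phi> \<alpha> \<beta>"]) (rule \<Phi>[OF _ rfl(2)])
  finally show ?thesis .
qed

lemma induced_hom_sphere_class:
  assumes "based_sphere_map n X x0 \<alpha>" "based_map X x0 Y y0 g"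
  shows "induced_hom n Y y0 g (sphere_class n X x0 \<alpha>) = sphere_class n Y y0 (g \<circ> \<alpha>)"
  unfolding induced_hom_def
  by (rule UN_sphere_class[OF assms(1), where \<Phi> = "\<lambda>\<alpha>. g \<circ> \<alpha>"]) (rule based_homotopic_compose[OF _ assms(2)])

lemma induced_hom_closed:
  assumes "c \<in> carrier (homotopy_group n X x0)" "based_map X x0 Y y0 g"
  shows "induced_hom n Y y0 g c \<in> carrier (homotopy_group n Y y0)"
proof -
  obtain \<alpha> where \<alpha>: "based_sphere_map n X x0 \<alpha>" "c = sphere_class n X x0 \<alpha>"
    using assms(1) unfolding carrier_homotopy_group by (elim exE conjE)
  show ?thesis
    unfolding carrier_homotopy_group \<alpha>(2) induced_hom_sphere_class[OF \<alpha>(1) assms(2)]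
    using based_map_compose[OF \<alpha>(1) assms(2)] by (intro exI[of _ "g \<circ> \<alpha>"]) simp
qed

lemma sphere_mult_homotopic:
  assumes "n \<ge> 1" "sphere_homotopic n X x0 \<alpha> \<alpha>'" "sphere_homotopic n X x0 \<beta> \<beta>'"
  shows "sphere_homotopic n X x0 (sphere_mult \<alpha> \<beta>) (sphere_mult \<alpha>' \<beta>')"
  unfolding sphere_mult_def
proof (rule based_homotopic_glue[OF _ _ _ _ _ _ _ _ assms(2,3)])
  show "continuous_map (nsphere n) euclideanreal (\<lambda>x. x 1)"
    by (rule continuous_map_nsphere_projection)
  show "continuous_map (subtopology (nsphere n) {x \<in> topspace (nsphere n). 0 \<le> x 1}) (nsphere n) pinch"
    "continuous_map (subtopology (nsphere n) {x \<in> topspace (nsphere n). x 1 \<le> 0}) (nsphere n) pinch"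
    by (intro continuous_map_from_subtopology continuous_map_pinch[OF assms(1)])+
  show "pinch x = sphere_base" "pinch x = sphere_base" if "0 = x 1" for x
    using that pinch_equator by simp_all
  show "0 = sphere_base 1" by (simp add: sphere_base_def)
qed (simp_all add: sphere_base_in_nsphere)

lemma mult_homotopy_group:
  assumes "n \<ge> 1" "based_sphere_map n X x0 \<alpha>" "based_sphere_map n X x0 \<beta>"
  shows "sphere_class n X x0 \<alpha> \<otimes>\<^bsub>homotopy_group n X x0\<^esub> sphere_class n X x0 \<beta>
    = sphere_class n X x0 (sphere_mult \<alpha> \<beta>)"
  unfolding homotopy_group_def monoid.simps
  by (rule UN_sphere_class2[OF assms(2,3) sphere_mult_homotopic[OF assms(1)]])

text \<open>The sphere is cut where the two radii agree, which is where \<open>(u, v)\<close> projects to the product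
  of the boundary spheres; there both collapses give the base point.\<close>

lemma whitehead_map_homotopic:
  assumes ml: "m \<ge> 1" "l \<ge> 1"
    and hom: "sphere_homotopic m X x0 \<alpha> \<alpha>'" "sphere_homotopic l X x0 \<beta> \<beta>'"
  shows "sphere_homotopic (m + l - 1) X x0 (whitehead_map m l \<alpha> \<beta>) (whitehead_map m l \<alpha>' \<beta>')"
proof -
  let ?S = "nsphere (m + l - 1)"
  let ?a = "\<lambda>x. radius m (whitehead_u m x)" and ?b = "\<lambda>x. radius l (whitehead_v m l x)"
  have a: "continuous_map ?S euclideanreal ?a" and b: "continuous_map ?S euclideanreal ?b"
    by (intro continuous_map_radius continuous_map_whitehead_u continuous_map_whitehead_v)+
  have pos: "?a x > 0 \<or> ?b x > 0" if "x \<in> topspace ?S" for x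
    using whitehead_uv_sphere[OF ml that] radius_nonneg[of m "whitehead_u m x"]
      radius_nonneg[of l "whitehead_v m l x"] by (auto simp: less_le)
  show ?thesis
    unfolding whitehead_map_eq
  proof (rule based_homotopic_glue[OF a b _ _ _ _ _ _ hom])
    show "continuous_map (subtopology ?S {x \<in> topspace ?S. ?a x \<le> ?b x}) (nsphere m)
        (\<lambda>x. disc_collapse m (\<lambda>i. whitehead_u m x i / ?b x))"
      using pos radius_nonneg ml(1)
      by (intro continuous_map_radial_collapse continuous_map_from_subtopology continuous_map_whitehead_u b)
        (force simp: whitehead_u_def)+
    show "continuous_map (subtopology ?S {x \<in> topspace ?S. ?b x \<le> ?a x}) (nsphere l)
        (\<lambda>x. disc_collapse l (\<lambda>i. whitehead_v m l x i / ?a x))"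
      using pos radius_nonneg ml(2)
      by (intro continuous_map_radial_collapse continuous_map_from_subtopology continuous_map_whitehead_v a)
        (force simp: whitehead_v_def)+
    show "disc_collapse m (\<lambda>i. whitehead_u m x i / ?b x) = sphere_base"
      "disc_collapse l (\<lambda>i. whitehead_v m l x i / ?a x) = sphere_base"
      if "x \<in> topspace ?S" "?a x = ?b x" for x
      using pos[OF that(1)] that(2) by (auto intro: disc_collapse_radial)
    show "sphere_base \<in> topspace ?S" by (rule sphere_base_in_nsphere)
    have uv: "whitehead_u m sphere_base = (\<lambda>i. sphere_base i / sqrt 2)"
       "whitehead_v m l sphere_base = (\<lambda>i. sphere_base i / sqrt 2)"
      using ml by (auto simp: whitehead_u_def whitehead_v_def sphere_base_def fun_eq_iff)
    show "?a sphere_base = ?b sphere_base"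
      using sum_sphere_base[OF ml(1)] sum_sphere_base[OF ml(2)]
      by (simp add: radius_def uv power_divide flip: sum_divide_distrib)
  qed
qed

lemma whitehead_product_sphere_class:
  assumes "m \<ge> 1" "l \<ge> 1" "based_sphere_map m X x0 \<alpha>" "based_sphere_map l X x0 \<beta>"
  shows "whitehead_product m l X x0 (sphere_class m X x0 \<alpha>) (sphere_class l X x0 \<beta>)
    = sphere_class (m + l - 1) X x0 (whitehead_map m l \<alpha> \<beta>)"
  unfolding whitehead_product_def
  by (rule UN_sphere_class2[OF assms(3,4) whitehead_map_homotopic[OF assms(1,2)]])

section \<open>Coverings and the generalized Gottlieb and Whitehead center groups\<close>

lemma covering_sphere_homotopic_iff:
  assumes "covering_map X' X p" "p x0' = x0" "n \<ge> 1"
    and "based_sphere_map n X' x0' \<alpha>" "based_sphere_map n X' x0' \<beta>"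
  shows "sphere_homotopic n X x0 (p \<circ> \<alpha>) (p \<circ> \<beta>) \<longleftrightarrow> sphere_homotopic n X' x0' \<alpha> \<beta>"
proof
  assume "sphere_homotopic n X x0 (p \<circ> \<alpha>) (p \<circ> \<beta>)"
  then show "sphere_homotopic n X' x0' \<alpha> \<beta>"
    using covering_reflects_based_homotopy[OF assms(1,2) connected_space_nsphere[OF assms(3)]
        sphere_base_in_nsphere assms(4,5)] by simp
next
  have "based_map X' x0' X x0 p"
    using assms(1,2) by (simp add: covering_map_def based_map_def)
  then show "sphere_homotopic n X x0 (p \<circ> \<alpha>) (p \<circ> \<beta>)" if "sphere_homotopic n X' x0' \<alpha> \<beta>"
    by (rule based_homotopic_compose[OF that])
qed

lemma induced_hom_covering_mon:
  assumes cov: "covering_map X' X p" and p: "p x0' = x0" and n: "n \<ge> 1"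
  shows "induced_hom n X x0 p \<in> mon (homotopy_group n X' x0') (homotopy_group n X x0)"
proof -
  have pb: "based_map X' x0' X x0 p"
    using cov p by (simp add: covering_map_def based_map_def)
  let ?G = "homotopy_group n X' x0'" and ?H = "homotopy_group n X x0" and ?p = "induced_hom n X x0 p"
  have "?p (c \<otimes>\<^bsub>?G\<^esub> d) = ?p c \<otimes>\<^bsub>?H\<^esub> ?p d" if cd: "c \<in> carrier ?G" "d \<in> carrier ?G" for c d
  proof -
    obtain \<alpha> \<beta> where \<alpha>: "based_sphere_map n X' x0' \<alpha>" "c = sphere_class n X' x0' \<alpha>"
      and \<beta>: "based_sphere_map n X' x0' \<beta>" "d = sphere_class n X' x0' \<beta>"
      using cd unfolding carrier_homotopy_group by blast
    have m: "based_sphere_map n X' x0' (sphere_mult \<alpha> \<beta>)"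
      using sphere_mult_homotopic[OF n \<alpha>(1)[folded based_homotopic_refl] \<beta>(1)[folded based_homotopic_refl]]
      by (simp only: based_homotopic_refl)
    have "p \<circ> sphere_mult \<alpha> \<beta> = sphere_mult (p \<circ> \<alpha>) (p \<circ> \<beta>)"
      by (auto simp: sphere_mult_def)
    then show ?thesis
      using \<alpha> \<beta> by (simp add: mult_homotopy_group[OF n] induced_hom_sphere_class[OF _ pb] m based_map_compose[OF _ pb])
  qed
  moreover have "inj_on ?p (carrier ?G)"
  proof (rule inj_onI)
    fix c d assume cd: "c \<in> carrier ?G" "d \<in> carrier ?G" and eq: "?p c = ?p d"
    obtain \<alpha> \<beta> where \<alpha>: "based_sphere_map n X' x0' \<alpha>" "c = sphere_class n X' x0' \<alpha>"
      and \<beta>: "based_sphere_map n X' x0' \<beta>" "d = sphere_class n X' x0' \<beta>"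
      using cd unfolding carrier_homotopy_group by blast
    from eq show "c = d"
      by (simp add: \<alpha> \<beta> induced_hom_sphere_class[OF _ pb] sphere_class_eq_iff based_map_compose[OF _ pb]
          covering_sphere_homotopic_iff[OF cov p n])
  qed
  ultimately show ?thesis
    using induced_hom_closed[OF _ pb] by (simp add: mon_def hom_def)
qed

text \<open>Composing with \<open>p\<close> gives one direction. Conversely, suppose that \<open>F\<close> extends
  \<open>p \<circ> f \<or> p \<circ> \<gamma>\<close> up to homotopy. Lifting this homotopy, starting from \<open>f \<or> \<gamma>\<close>, ends at a lift
  \<open>E\<close> of the restriction of \<open>F\<close> to the wedge, and \<open>F\<close> itself lifts to an extension \<open>G\<close> of \<open>E\<close>.\<close>

lemma covering_gottlieb_group:
  assumes cov: "covering_map X' X p" and p: "p x0' = x0"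
    and A: "connected_space A" "a0 \<in> topspace A" and f: "based_map A a0 X' x0' f" and m: "m \<ge> 1"
    and c: "c \<in> carrier (homotopy_group m X' x0')"
  shows "c \<in> gottlieb_group m A a0 X' x0' f \<longleftrightarrow>
    induced_hom m X x0 p c \<in> gottlieb_group m A a0 X x0 (p \<circ> f)"
proof -
  let ?S = "nsphere m"
  let ?W = "wedge A a0 ?S sphere_base" and ?w = "(a0, sphere_base)"
  have pb: "based_map X' x0' X x0 p"
    using cov p by (simp add: covering_map_def based_map_def)
  obtain \<gamma> where \<gamma>: "based_sphere_map m X' x0' \<gamma>" "c = sphere_class m X' x0' \<gamma>"
    using c unfolding carrier_homotopy_group by blast
  have pc: "induced_hom m X x0 p c = sphere_class m X x0 (p \<circ> \<gamma>)"
    by (simp add: \<gamma> induced_hom_sphere_class[OF _ pb])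
  have pw: "p \<circ> wedge_map sphere_base f \<alpha> = wedge_map sphere_base (p \<circ> f) (p \<circ> \<alpha>)" for \<alpha>
    by (auto simp: wedge_map_def)
  note sb = sphere_base_in_nsphere[of m]
  have W: "?w \<in> topspace ?W" using A(2) sb by (simp add: topspace_wedge)
  show ?thesis
  proof
    assume "c \<in> gottlieb_group m A a0 X' x0' f"
    then obtain \<alpha> F where \<alpha>: "\<alpha> \<in> c" and F: "based_map (prod_topology A ?S) ?w X' x0' F"
      and hom: "based_homotopic ?W ?w X' x0' F (wedge_map sphere_base f \<alpha>)"
      unfolding gottlieb_group_def by blast
    have "p \<circ> \<alpha> \<in> induced_hom m X x0 p c"
      using \<alpha> \<gamma>(2) unfolding pc mem_sphere_class by (simp add: mem_sphere_class based_homotopic_compose[OF _ pb])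
    moreover have "based_map (prod_topology A ?S) ?w X x0 (p \<circ> F)"
      by (rule based_map_compose[OF F pb])
    moreover have "based_homotopic ?W ?w X x0 (p \<circ> F) (wedge_map sphere_base (p \<circ> f) (p \<circ> \<alpha>))"
      using based_homotopic_compose[OF hom pb] by (simp only: pw)
    ultimately show "induced_hom m X x0 p c \<in> gottlieb_group m A a0 X x0 (p \<circ> f)"
      using induced_hom_closed[OF c pb] unfolding gottlieb_group_def by blast
  next
    assume "induced_hom m X x0 p c \<in> gottlieb_group m A a0 X x0 (p \<circ> f)"
    then obtain \<beta> F where \<beta>: "sphere_homotopic m X x0 (p \<circ> \<gamma>) \<beta>"
      and F: "based_map (prod_topology A ?S) ?w X x0 F"
      and hom: "based_homotopic ?W ?w X x0 F (wedge_map sphere_base (p \<circ> f) \<beta>)"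
      unfolding gottlieb_group_def pc mem_sphere_class[symmetric] by blast
    have "based_homotopic ?W ?w X x0 (wedge_map sphere_base (p \<circ> f) (p \<circ> \<gamma>)) F"
      using based_homotopic_wedge_map[OF based_map_compose[OF f pb] \<beta> A(2) sb] hom
      by (meson based_homotopic_sym based_homotopic_trans)
    then have "based_homotopic ?W ?w X x0 (p \<circ> wedge_map sphere_base f \<gamma>) F"
      by (simp only: pw)
    moreover have "based_map ?W ?w X' x0' (wedge_map sphere_base f \<gamma>)"
      using based_homotopic_wedge_map[OF f \<gamma>(1)[folded based_homotopic_refl] A(2) sb]
      by (simp add: based_homotopic_refl)
    ultimately obtain E where E: "based_homotopic ?W ?w X' x0' (wedge_map sphere_base f \<gamma>) E"
      and pE: "\<forall>w\<in>topspace ?W. p (E w) = F w"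
      using covering_lift_based_homotopy[OF cov p W] by blast
    have Eb: "based_map ?W ?w X' x0' E" by (rule based_homotopic_imp_based_maps(2)[OF E])
    then have Ec: "continuous_map ?W X' E" by (simp add: based_map_def)
    have ia: "continuous_map A ?W (\<lambda>a. (a, sphere_base))" and iS: "continuous_map ?S ?W (\<lambda>s. (a0, s))"
      unfolding wedge_def using A(2) sb
      by (auto simp: continuous_map_in_subtopology continuous_map_pairwise o_def)
    have q: "disc_collapse m sphere_base = sphere_base"
      by (rule disc_collapse_boundary[OF sum_sphere_base[OF m]])
    have Eac: "continuous_map A X' (\<lambda>a. E (a, sphere_base))"
      and Esc: "continuous_map ?S X' (\<lambda>s. E (a0, s))"
      using continuous_map_compose[OF ia Ec] continuous_map_compose[OF iS Ec] by (simp_all add: o_def)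
    have Fc: "continuous_map (prod_topology A ?S) X F" using F by (simp add: based_map_def)
    have pEa: "\<forall>a\<in>topspace A. p (E (a, sphere_base)) = F (a, sphere_base)"
      and pEs: "\<forall>s\<in>topspace ?S. p (E (a0, s)) = F (a0, s)"
      using pE A(2) sb by (auto simp: topspace_wedge)
    obtain G where G: "continuous_map (prod_topology A ?S) X' G"
      and Ga: "\<forall>a\<in>topspace A. G (a, sphere_base) = E (a, sphere_base)"
      and Gs: "\<forall>s\<in>topspace ?S. G (a0, s) = E (a0, s)"
      using covering_lift_product[where q = "disc_collapse m" and ?b0.0 = sphere_base, OF cov A
          contractible_space_disc compact_space_disc sphere_base_in_disc[OF m] Hausdorff_space_nsphere
          continuous_map_disc_collapse disc_collapse_surj[OF m] q Fc Eac pEa Esc pEs refl]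
      by (elim exE conjE)
    have "G w = E w" if "w \<in> topspace ?W" for w
      using that Ga Gs by (auto simp: topspace_wedge)
    then have "based_homotopic ?W ?w X' x0' E G"
      by (intro based_homotopic_cong[OF Eb W]) simp
    with E have "based_homotopic ?W ?w X' x0' G (wedge_map sphere_base f \<gamma>)"
      by (meson based_homotopic_sym based_homotopic_trans)
    moreover have "based_map (prod_topology A ?S) ?w X' x0' G"
      using G Ga A(2) Eb by (simp add: based_map_def)
    moreover have "\<gamma> \<in> c" using \<gamma> by (simp add: mem_sphere_class based_homotopic_refl)
    ultimately show "c \<in> gottlieb_group m A a0 X' x0' f"
      using c unfolding gottlieb_group_def by blast
  qed
qed

text \<open>\<open>p\<close> maps the Whitehead product of \<open>\<gamma>\<close> and \<open>f \<circ> \<delta>\<close> to that of \<open>p \<circ> \<gamma>\<close> and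
  \<open>p \<circ> f \<circ> \<delta>\<close>, and reflects triviality of classes in degree \<open>m + l - 1\<close>.\<close>

lemma covering_whitehead_center:
  assumes cov: "covering_map X' X p" and p: "p x0' = x0"
    and f: "based_map A a0 X' x0' f" and m: "m \<ge> 1" and x0': "x0' \<in> topspace X'"
    and c: "c \<in> carrier (homotopy_group m X' x0')"
  shows "c \<in> whitehead_center m A a0 X' x0' f \<longleftrightarrow>
    induced_hom m X x0 p c \<in> whitehead_center m A a0 X x0 (p \<circ> f)"
proof -
  have pb: "based_map X' x0' X x0 p"
    using cov p by (simp add: covering_map_def based_map_def)
  obtain \<gamma> where \<gamma>: "based_sphere_map m X' x0' \<gamma>" "c = sphere_class m X' x0' \<gamma>"
    using c unfolding carrier_homotopy_group by blast
  have "whitehead_product m l X x0 (induced_hom m X x0 p c) (induced_hom l X x0 (p \<circ> f) d)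
          = \<one>\<^bsub>homotopy_group (m + l - 1) X x0\<^esub> \<longleftrightarrow>
        whitehead_product m l X' x0' c (induced_hom l X' x0' f d)
          = \<one>\<^bsub>homotopy_group (m + l - 1) X' x0'\<^esub>"
    if l: "l \<ge> 1" and d: "d \<in> carrier (homotopy_group l A a0)" for l d
  proof -
    obtain \<delta> where \<delta>: "based_sphere_map l A a0 \<delta>" "d = sphere_class l A a0 \<delta>"
      using d unfolding carrier_homotopy_group by blast
    have f\<delta>: "based_sphere_map l X' x0' (f \<circ> \<delta>)" by (rule based_map_compose[OF \<delta>(1) f])
    let ?w = "whitehead_map m l \<gamma> (f \<circ> \<delta>)"
    have w: "based_sphere_map (m + l - 1) X' x0' ?w"
      using whitehead_map_homotopic[OF m l \<gamma>(1)[folded based_homotopic_refl] f\<delta>[folded based_homotopic_refl]]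
      by (simp only: based_homotopic_refl)
    have const: "based_sphere_map (m + l - 1) X' x0' (\<lambda>_. x0')" "based_sphere_map (m + l - 1) X x0 (\<lambda>_. x0)"
      using x0' pb p by (auto simp: based_map_def continuous_map_def)
    have "p \<circ> ?w = whitehead_map m l (p \<circ> \<gamma>) ((p \<circ> f) \<circ> \<delta>)"
      unfolding whitehead_map_eq by auto
    moreover have "p \<circ> (\<lambda>_::nat \<Rightarrow> real. x0') = (\<lambda>_. x0)" using p by auto
    ultimately have "sphere_homotopic (m + l - 1) X x0 (whitehead_map m l (p \<circ> \<gamma>) ((p \<circ> f) \<circ> \<delta>)) (\<lambda>_. x0)
        \<longleftrightarrow> sphere_homotopic (m + l - 1) X' x0' ?w (\<lambda>_. x0')"
      using covering_sphere_homotopic_iff[OF cov p _ w const(1)] m l by simp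
    moreover have "induced_hom l X x0 (p \<circ> f) d = sphere_class l X x0 ((p \<circ> f) \<circ> \<delta>)"
      unfolding \<delta>(2) by (rule induced_hom_sphere_class[OF \<delta>(1) based_map_compose[OF f pb]])
    moreover have "induced_hom l X' x0' f d = sphere_class l X' x0' (f \<circ> \<delta>)"
      unfolding \<delta>(2) by (rule induced_hom_sphere_class[OF \<delta>(1) f])
    moreover have "induced_hom m X x0 p c = sphere_class m X x0 (p \<circ> \<gamma>)"
      unfolding \<gamma>(2) by (rule induced_hom_sphere_class[OF \<gamma>(1) pb])
    ultimately show ?thesis
      using \<gamma> f\<delta> const m l based_map_compose[OF \<gamma>(1) pb]
        based_map_compose[OF \<delta>(1) based_map_compose[OF f pb]]
      by (simp add: whitehead_product_sphere_class one_homotopy_group sphere_class_eq_iff)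
  qed
  then show ?thesis
    using c induced_hom_closed[OF c pb] unfolding whitehead_center_def by auto
qed


theorem theorem1p10:
  fixes A :: "'a topology" and X' :: "'b topology" and X :: "'c topology"
    and KA :: "'ka topology" and KX' :: "'kb topology" and KX :: "'kc topology"
    and p :: "'b \<Rightarrow> 'c" and f :: "'a \<Rightarrow> 'b"
    and a0 :: 'a and x0' :: 'b and x0 :: 'c and m :: nat
  assumes "path_connected_space A" and "CW_complex KA" and "A homotopy_equivalent_space KA"
    and "path_connected_space X'" and "CW_complex KX'" and "X' homotopy_equivalent_space KX'"
    and "path_connected_space X" and "CW_complex KX" and "X homotopy_equivalent_space KX"
    and "a0 \<in> topspace A" and "x0' \<in> topspace X'" and "x0 \<in> topspace X"
    and "covering_map X' X p" and "p x0' = x0"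
    and "based_map A a0 X' x0' f"
    and "m \<ge> 1"
  shows "induced_hom m X x0 p \<in> mon (homotopy_group m X' x0') (homotopy_group m X x0) \<and>
    gottlieb_group m A a0 X' x0' f =
      {c \<in> carrier (homotopy_group m X' x0').
         induced_hom m X x0 p c \<in> gottlieb_group m A a0 X x0 (p \<circ> f)} \<and>
    whitehead_center m A a0 X' x0' f =
      {c \<in> carrier (homotopy_group m X' x0').
         induced_hom m X x0 p c \<in> whitehead_center m A a0 X x0 (p \<circ> f)}"
proof (intro conjI)
  have A: "connected_space A"
    using \<open>path_connected_space A\<close> by (rule path_connected_imp_connected_space)
  show "induced_hom m X x0 p \<in> mon (homotopy_group m X' x0') (homotopy_group m X x0)"
    by (rule induced_hom_covering_mon) fact+
  have "c \<in> gottlieb_group m A a0 X' x0' f \<longleftrightarrow>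
      induced_hom m X x0 p c \<in> gottlieb_group m A a0 X x0 (p \<circ> f)"
    if "c \<in> carrier (homotopy_group m X' x0')" for c
    by (rule covering_gottlieb_group) fact+
  moreover have "gottlieb_group m A a0 X' x0' f \<subseteq> carrier (homotopy_group m X' x0')"
    by (auto simp: gottlieb_group_def)
  ultimately show "gottlieb_group m A a0 X' x0' f =
      {c \<in> carrier (homotopy_group m X' x0').
         induced_hom m X x0 p c \<in> gottlieb_group m A a0 X x0 (p \<circ> f)}"
    by blast
  have "c \<in> whitehead_center m A a0 X' x0' f \<longleftrightarrow>
      induced_hom m X x0 p c \<in> whitehead_center m A a0 X x0 (p \<circ> f)"
    if "c \<in> carrier (homotopy_group m X' x0')" for c
    by (rule covering_whitehead_center) fact+
  moreover have "whitehead_center m A a0 X' x0' f \<subseteq> carrier (homotopy_group m X' x0')"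
    by (auto simp: whitehead_center_def)
  ultimately show "whitehead_center m A a0 X' x0' f =
      {c \<in> carrier (homotopy_group m X' x0').
         induced_hom m X x0 p c \<in> whitehead_center m A a0 X x0 (p \<circ> f)}"
    by blast
qed

end
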